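(* Suppose that $g,\psi\in L_1(\mathbb{R})$ are such that $1+(T_cg)(y)\neq0$ for every $y\in\mathbb{R}$. Then the equation $$f(x)+\big(g\underset{T_c}{*}f\big)(x)=\big(g\underset{T_c}{\overset{\gamma}{*}}\psi\big)(x)$$ in the unknown function $f$ has a unique solution in $L_1(\mathbb{R})$, which can be represented in the form $$f(x)=\big(l\underset{T_c}{\overset{\gamma}{*}}\psi\big)(x),$$ where $l\in L_1(\mathbb{R})$ is defined by $(T_cl)(y)=\dfrac{(T_cg)(y)}{1+(T_cg)(y)}$ for all $y\in\mathbb{R}$. Furthermore, $$\|f\|_{L_1(\mathbb{R})}\leq\frac{1}{\sqrt{2\pi}}\|l\|_{L_1(\mathbb{R})}\|\psi\|_{L_1(\mathbb{R})}.$$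
   Context: For $f\in L_1(\mathbb{R})$, the transform $T_c$ is $$(T_cf)(y)=\frac{1}{\sqrt{2\pi}}\int_{\mathbb{R}}f(x)\cos(xy)\,dx,\quad y\in\mathbb{R}.$$ The (unweighted) convolution for $T_c$ is $$\big(f\underset{T_c}{*}g\big)(x):=\frac{1}{2\sqrt{2\pi}}\int_{\mathbb{R}}[f(x+u)+f(x-u)]\,g(u)\,du,$$ so that $\big(g\underset{T_c}{*}f\big)(x)=\frac{1}{2\sqrt{2\pi}}\int_{\mathbb{R}}[g(x+u)+g(x-u)]\,f(u)\,du$. The iterated convolution with Gaussian weight $\gamma(y)=e^{-\frac12y^2}$ is $$\big(f\underset{T_c}{\overset{\gamma}{*}}g\big)(x):=\frac{1}{8\pi}\int_{\mathbb{R}^2}f(u)g(v)G(x,u,v)\,du\,dv,\quad x\in\mathbb{R},$$ where $$G(x,u,v)=e^{-\frac12(x+u+v)^2}+e^{-\frac12(x+u-v)^2}+e^{-\frac12(x-u+v)^2}+e^{-\frac12(x-u-v)^2}.$$ Functions in $L_1(\mathbb{R})$ are identified when equal almost everywhere.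
   Formalization: The representation f = l *^γ ψ and the norm bound are proved only for g even almost everywhere, as they fail in general (e.g. g(x)=exp(-(x-1)²/2), ψ(x)=exp(-x²/2)); existence and uniqueness of f and existence of l are proved for all g as stated. *)

theory Defs
  imports "HOL-Analysis.Analysis"
begin

text \<open>
  Elements of \<open>L\<^sub>1(\<real>)\<close> are represented by functions \<open>f :: real \<Rightarrow> complex\<close> with
  \<open>integrable lborel f\<close>. Identification of functions that agree almost everywhere is
  made explicit by \<open>AE x in lborel\<close>.
\<close>

definition cos_transform :: "(real \<Rightarrow> complex) \<Rightarrow> real \<Rightarrow> complex" where
  "cos_transform f y =
     complex_of_real (1 / sqrt (2 * pi)) * (LINT x|lborel. f x * complex_of_real (cos (x * y)))"

text \<open>
  The integral defining \<open>cos_conv f g x\<close> converges absolutely only for almost every \<open>x\<close>.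
  At the other points the Bochner integral has the default value \<open>0\<close>. The operation is
  not commutative. If \<open>f\<close> is even, then \<open>cos_conv g f\<close> is a multiple of the
  ordinary convolution of \<open>g\<close> and \<open>f\<close>, which need not be even, whereas
  \<open>gauss_conv g \<psi>\<close> below is always even. Hence a solution of
  \<open>f + cos_conv g f = gauss_conv g \<psi>\<close> is in general not even, and so not of the form
  \<open>gauss_conv l \<psi>\<close>, unless \<open>g\<close> is even almost everywhere.
\<close>

definition cos_conv :: "(real \<Rightarrow> complex) \<Rightarrow> (real \<Rightarrow> complex) \<Rightarrow> real \<Rightarrow> complex" where
  "cos_conv f g x =
     complex_of_real (1 / (2 * sqrt (2 * pi))) * (LINT u|lborel. (f (x + u) + f (x - u)) * g u)"

definition gauss_kernel :: "real \<Rightarrow> real \<Rightarrow> real \<Rightarrow> real" where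
  "gauss_kernel x u v =
     exp (- (1/2) * (x + u + v)\<^sup>2) + exp (- (1/2) * (x + u - v)\<^sup>2)
   + exp (- (1/2) * (x - u + v)\<^sup>2) + exp (- (1/2) * (x - u - v)\<^sup>2)"

definition gauss_conv :: "(real \<Rightarrow> complex) \<Rightarrow> (real \<Rightarrow> complex) \<Rightarrow> real \<Rightarrow> complex" where
  "gauss_conv f g x =
     complex_of_real (1 / (8 * pi)) * (LINT p|(lborel :: (real \<times> real) measure).
        f (fst p) * g (snd p) * complex_of_real (gauss_kernel x (fst p) (snd p)))"

definition L1_norm :: "(real \<Rightarrow> complex) \<Rightarrow> real" where
  "L1_norm f = (LINT x|lborel. norm (f x))"

definition L1_solution ::
    "(real \<Rightarrow> complex) \<Rightarrow> (real \<Rightarrow> complex) \<Rightarrow> (real \<Rightarrow> complex) \<Rightarrow> bool" where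
  "L1_solution g \<psi> f \<longleftrightarrow>
     integrable lborel f \<and> (AE x in lborel. f x + cos_conv g f x = gauss_conv g \<psi> x)"

text \<open>
  The cosine transform only sees the even part of a function, so this condition determines
  \<open>l\<close> up to an odd summand. \<open>gauss_conv l \<psi>\<close> does not depend on that summand, but
  \<open>L1_norm l\<close> does.
\<close>

definition L1_resolvent :: "(real \<Rightarrow> complex) \<Rightarrow> (real \<Rightarrow> complex) \<Rightarrow> bool" where
  "L1_resolvent g l \<longleftrightarrow>
     integrable lborel l \<and>
     (\<forall>y. cos_transform l y = cos_transform g y / (1 + cos_transform g y))"

end

theory Submission
  imports Defs "HOL-Probability.Probability" "HOL-Real_Asymp.Real_Asymp"
begin

text \<open>
  Taking Fourier transforms, which are injective on \<open>L\<^sub>1\<close>, turns the equation into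
  \<open>F f(y) + (2\<pi>)\<^sup>-\<^sup>1\<^sup>/\<^sup>2 F g(y) (F f(y) + F f(-y)) / 2 = F h(y)\<close> with \<open>h = gauss_conv g \<psi>\<close>. Since \<open>F h\<close> is
  even, adding the equations at \<open>y\<close> and \<open>-y\<close> determines the even part of \<open>F f\<close> as
  \<open>F h / (1 + T\<^sub>c g)\<close>, and hence \<open>F f\<close>. That these quotients are transforms of \<open>L\<^sub>1\<close> functions is
  Wiener's lemma: if \<open>1 + F u\<close> has no zero, then \<open>1 / (1 + F u) - 1\<close> is again a transform.

  Wiener's lemma is proved by Newman's method. By the Riemann-Lebesgue lemma \<open>|1 + F u| \<ge> d > 0\<close>. Choose \<open>k\<close>
  with smooth, rapidly decaying \<open>F k\<close> and \<open>\<parallel>u - k\<parallel> < d/4\<close>, and put \<open>P = 1 + F k\<close>, \<open>r = F k - F u\<close>, so that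
  \<open>|P| \<ge> 3d/4\<close> and \<open>1 / (1 + F u) = (\<Sum>n. r\<^sup>n / P\<^sup>n\<^sup>+\<^sup>1)\<close>. The \<open>L\<^sub>1\<close> norm belonging to \<open>r\<^sup>n\<close> is at most \<open>(d/4)\<^sup>n\<close>, and
  the one belonging to \<open>P\<^sup>-\<^sup>n - 1\<close> is controlled by two derivatives of this function, thus by
  \<open>O(n\<^sup>2 (4/(3d))\<^sup>n)\<close>; the series converges geometrically.
\<close>

section \<open>Continuity of translation\<close>

lemma integrable_translate:
  fixes f :: "real \<Rightarrow> 'a::{banach, second_countable_topology}"
  assumes "integrable lborel f"
  shows "integrable lborel (\<lambda>x. f (x - t))"
  using lborel_integrable_real_affine[OF assms, of 1 "-t"] by simp

lemma integrable_reflect: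
  fixes f :: "real \<Rightarrow> 'a::{banach, second_countable_topology}"
  assumes "integrable lborel f"
  shows "integrable lborel (\<lambda>x. f (t - x))"
  using lborel_integrable_real_affine[OF assms, of "-1" t] by simp

lemma integral_translate:
  fixes f :: "real \<Rightarrow> 'a::{banach, second_countable_topology}"
  shows "(LINT x|lborel. f (x - t)) = (LINT x|lborel. f x)"
  using lborel_integral_real_affine[of 1 f "-t"] by simp

lemma integral_reflect:
  fixes f :: "real \<Rightarrow> 'a::{banach, second_countable_topology}"
  shows "(LINT x|lborel. f (t - x)) = (LINT x|lborel. f x)"
  using lborel_integral_real_affine[of "-1" f t] by simp

text \<open>Points of an open \<open>U\<close> stay in \<open>U\<close> under small shifts, so the
  positive part of \<open>?i x - ?i (x - X n)\<close> tends to 0 everywhere, dominated by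
  \<open>?i\<close>. The negative part has the same integral because translation preserves measure;
  this avoids pointwise convergence on the boundary of \<open>U\<close>, which may have positive
  measure.\<close>

lemma translation_tendsto_open:
  fixes c :: "'a::{banach, second_countable_topology}" and U :: "real set"
  assumes U: "open U" "emeasure lborel U < \<infinity>" and X: "X \<longlonglongrightarrow> 0"
  shows "(\<lambda>n. LINT x|lborel. norm (indicator U (x - X n) *\<^sub>R c - indicator U x *\<^sub>R c)) \<longlonglongrightarrow> 0"
proof -
  let ?i = "indicator U :: real \<Rightarrow> real"
  have [measurable]: "U \<in> sets borel" using U by simp
  have int: "integrable lborel ?i" using U by simp
  have int': "integrable lborel (\<lambda>x. ?i (x - t))" for t using int by (rule integrable_translate)
  have intm: "integrable lborel (\<lambda>x. max 0 (?i x - ?i (x - t)))" for t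
    using int int' by (intro integrable_max) auto
  have lim: "(\<lambda>n. LINT x|lborel. max 0 (?i x - ?i (x - X n))) \<longlonglongrightarrow> (LINT x|(lborel::real measure). (0::real))"
  proof (rule integral_dominated_convergence[where w = ?i])
    have "(\<lambda>n. max 0 (?i x - ?i (x - X n))) \<longlonglongrightarrow> 0" for x
    proof (cases "x \<in> U")
      case True
      have "(\<lambda>n. x - X n) \<longlonglongrightarrow> x - 0" by (intro tendsto_intros X)
      then have "eventually (\<lambda>n. x - X n \<in> U) sequentially"
        using U True by (intro topological_tendstoD) auto
      then have "eventually (\<lambda>n. max 0 (?i x - ?i (x - X n)) = 0) sequentially"
        by eventually_elim (use True in auto)
      then show ?thesis by (rule tendsto_eventually)
    qed (auto simp: indicator_def)
    then show "AE x in lborel. (\<lambda>n. max 0 (?i x - ?i (x - X n))) \<longlonglongrightarrow> 0" by simp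
  qed (use int in \<open>auto simp: indicator_def\<close>)
  \<comment> \<open>Expresses the absolute value through its positive part: after integration the
    two remaining terms cancel.\<close>
  have abs_eq: "\<bar>?i (x - t) - ?i x\<bar> = 2 * max 0 (?i x - ?i (x - t)) + ?i (x - t) - ?i x" for x t
    by (auto simp: indicator_def)
  have "(LINT x|lborel. norm (indicator U (x - t) *\<^sub>R c - indicator U x *\<^sub>R c))
      = 2 * (LINT x|lborel. max 0 (?i x - ?i (x - t))) * norm c" for t
  proof -
    have "(LINT x|lborel. norm (indicator U (x - t) *\<^sub>R c - indicator U x *\<^sub>R c))
        = (LINT x|lborel. \<bar>?i (x - t) - ?i x\<bar> * norm c)"
      by (simp flip: scaleR_diff_left)
    also have "\<dots> = (LINT x|lborel. 2 * max 0 (?i x - ?i (x - t)) + ?i (x - t) - ?i x) * norm c"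
      by (simp add: abs_eq)
    also have "(LINT x|lborel. 2 * max 0 (?i x - ?i (x - t)) + ?i (x - t) - ?i x)
        = 2 * (LINT x|lborel. max 0 (?i x - ?i (x - t))) + (LINT x|lborel. ?i (x - t)) - (LINT x|lborel. ?i x)"
      using int int' intm by (subst Bochner_Integration.integral_diff Bochner_Integration.integral_add; auto)+
    finally show ?thesis by (simp add: integral_translate)
  qed
  then show ?thesis
    using tendsto_mult[OF tendsto_mult[OF tendsto_const lim, of 2] tendsto_const, of "norm c"] by simp
qed

text \<open>Translation is an isometry of L1, so the shift error of \<open>f\<close> exceeds that of
  an approximant \<open>g\<close> by at most twice the distance from \<open>f\<close> to
  \<open>g\<close>. Hence the property passes to L1 limits.\<close>

lemma translation_tendsto_limit:
  fixes f :: "real \<Rightarrow> 'a::{banach, second_countable_topology}"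
  assumes f: "integrable lborel f"
    and approx: "\<And>e. e > 0 \<Longrightarrow> \<exists>g. integrable lborel g \<and> (LINT x|lborel. norm (f x - g x)) < e \<and>
      (\<lambda>n. LINT x|lborel. norm (g (x - X n) - g x)) \<longlonglongrightarrow> 0"
  shows "(\<lambda>n. LINT x|lborel. norm (f (x - X n) - f x)) \<longlonglongrightarrow> 0"
proof (rule LIMSEQ_I)
  fix e :: real assume "e > 0"
  then obtain g where g: "integrable lborel g" "(LINT x|lborel. norm (f x - g x)) < e/4"
    and lim: "(\<lambda>n. LINT x|lborel. norm (g (x - X n) - g x)) \<longlonglongrightarrow> 0"
    using approx[of "e/4"] by auto
  note int = f g(1) f[THEN integrable_translate] g(1)[THEN integrable_translate]
  obtain N where N: "\<And>n. n \<ge> N \<Longrightarrow> norm ((LINT x|lborel. norm (g (x - X n) - g x)) - 0) < e/4"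
    using LIMSEQ_D[OF lim, of "e/4"] \<open>e > 0\<close> by auto
  have "(LINT x|lborel. norm (f (x - X n) - f x)) < e" if "n \<ge> N" for n
  proof -
    let ?d = "\<lambda>x. norm (f x - g x)"
    have "(LINT x|lborel. norm (f (x - X n) - f x))
        \<le> (LINT x|lborel. (?d (x - X n) + norm (g (x - X n) - g x)) + ?d x)"
    proof (rule integral_mono)
      fix x
      have "f (x - X n) - f x = (f (x - X n) - g (x - X n)) + (g (x - X n) - g x) - (f x - g x)" by simp
      then show "norm (f (x - X n) - f x) \<le> (?d (x - X n) + norm (g (x - X n) - g x)) + ?d x"
        by (metis norm_triangle_ineq norm_triangle_ineq4 add_right_mono order_trans)
    qed (use int in auto)
    also have "\<dots> = (LINT x|lborel. ?d (x - X n)) + (LINT x|lborel. norm (g (x - X n) - g x)) + (LINT x|lborel. ?d x)"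
      using int by (subst Bochner_Integration.integral_add; auto)+
    also have "(LINT x|lborel. ?d (x - X n)) = (LINT x|lborel. ?d x)"
      by (rule integral_translate)
    finally show ?thesis using N[OF that] g(2) \<open>e > 0\<close> by simp
  qed
  then show "\<exists>N. \<forall>n\<ge>N. norm ((LINT x|lborel. norm (f (x - X n) - f x)) - 0) < e"
    by (intro exI[of _ N]) simp
qed

text \<open>Induction over integrable functions. The closure lemma is used twice: from open sets to
  Borel sets of finite measure by outer regularity, and from simple functions to their dominated
  limits.\<close>

lemma translation_tendsto_L1:
  fixes f :: "real \<Rightarrow> 'a::{banach, second_countable_topology}"
  assumes f: "integrable lborel f" and X: "X \<longlonglongrightarrow> 0"
  shows "(\<lambda>n. LINT x|lborel. norm (f (x - X n) - f x)) \<longlonglongrightarrow> 0"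
  using f
proof (induction rule: integrable_induct)
  case (base A c)
  show ?case
  proof (rule translation_tendsto_limit)
    show "integrable lborel (\<lambda>x. indicator A x *\<^sub>R c)" using base by auto
    fix e :: real assume "e > 0"
    \<comment> \<open>The summand 1 keeps the denominator positive also for
      \<open>c = 0\<close>.\<close>
    then have "e / (norm c + 1) > 0" by (simp add: add_nonneg_pos)
    then obtain U where U: "open U" "A \<subseteq> U" "emeasure lborel (U - A) < e / (norm c + 1)"
      using outer_regular_lborel[of A "e / (norm c + 1)"] base by auto
    have [measurable]: "U \<in> sets borel" "A \<in> sets borel" using U base by simp_all
    have fin: "emeasure lborel U < \<infinity>"
    proof -
      have "U = A \<union> (U - A)" using U by auto
      then have "emeasure lborel U \<le> emeasure lborel A + emeasure lborel (U - A)"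
        using emeasure_subadditive[of A lborel "U - A"] by simp
      also have "\<dots> < \<infinity>" using base order.strict_trans[OF U(3) ennreal_less_top] by (simp add: less_top)
      finally show ?thesis .
    qed
    have "(LINT x|lborel. norm (indicator A x *\<^sub>R c - indicator U x *\<^sub>R c))
        = (LINT x|lborel. indicator (U - A) x * norm c)"
      using U(2) by (intro Bochner_Integration.integral_cong) (auto simp: indicator_def)
    also have "\<dots> = measure lborel (U - A) * norm c" by simp
    also have "\<dots> < e"
    proof -
      have "measure lborel (U - A) < e / (norm c + 1)"
        using U(3) \<open>e / (norm c + 1) > 0\<close> by (simp add: measure_def enn2real_less_iff order.strict_trans)
      then have "measure lborel (U - A) * (norm c + 1) < e"
        by (simp add: pos_less_divide_eq add_nonneg_pos)
      then show ?thesis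
        using measure_nonneg[of lborel "U - A"] by (simp only: distrib_left mult_1_right)
    qed
    finally show "\<exists>g. integrable lborel g \<and> (LINT x|lborel. norm (indicator A x *\<^sub>R c - g x)) < e \<and>
      (\<lambda>n. LINT x|lborel. norm (g (x - X n) - g x)) \<longlonglongrightarrow> 0"
      using fin translation_tendsto_open[OF U(1) fin X, of c]
      by (intro exI[of _ "\<lambda>x. indicator U x *\<^sub>R c"]) auto
  qed
next
  case (add f g)
  note int = add.hyps add.hyps[THEN integrable_translate]
  show ?case
  proof (rule tendsto_sandwich[OF _ _ tendsto_const])
    show "(\<lambda>n. (LINT x|lborel. norm (f (x - X n) - f x)) + (LINT x|lborel. norm (g (x - X n) - g x))) \<longlonglongrightarrow> 0"
      using tendsto_add[OF add.IH] by simp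
    have "(LINT x|lborel. norm (f (x - X n) + g (x - X n) - (f x + g x)))
        \<le> (LINT x|lborel. norm (f (x - X n) - f x)) + (LINT x|lborel. norm (g (x - X n) - g x))" for n
    proof -
      have "(LINT x|lborel. norm (f (x - X n) + g (x - X n) - (f x + g x)))
          \<le> (LINT x|lborel. norm (f (x - X n) - f x) + norm (g (x - X n) - g x))"
        using int by (intro integral_mono norm_diff_triangle_ineq) auto
      also have "\<dots> = (LINT x|lborel. norm (f (x - X n) - f x)) + (LINT x|lborel. norm (g (x - X n) - g x))"
        using int by (intro Bochner_Integration.integral_add) auto
      finally show ?thesis .
    qed
    then show "eventually (\<lambda>n. (LINT x|lborel. norm (f (x - X n) + g (x - X n) - (f x + g x)))
       \<le> (LINT x|lborel. norm (f (x - X n) - f x)) + (LINT x|lborel. norm (g (x - X n) - g x))) sequentially"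
      by simp
  qed auto
next
  case (lim f s)
  show ?case
  proof (rule translation_tendsto_limit[OF lim.hyps(4)])
    fix e :: real assume "e > 0"
    \<comment> \<open>The approximants satisfy \<open>norm (s i x) \<le> 2 * norm (f x)\<close>,
      whence the dominating function \<open>3 * norm (f x)\<close>.\<close>
    have "(\<lambda>i. LINT x|lborel. norm (f x - s i x)) \<longlonglongrightarrow> (LINT x|(lborel::real measure). (0::real))"
    proof (rule integral_dominated_convergence[where w = "\<lambda>x. 3 * norm (f x)"])
      show "AE x in lborel. (\<lambda>i. norm (f x - s i x)) \<longlonglongrightarrow> 0"
      proof (rule AE_I2)
        fix x
        have "(\<lambda>i. norm (f x - s i x)) \<longlonglongrightarrow> norm (f x - f x)"
          by (intro tendsto_intros lim.hyps(2)) simp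
        then show "(\<lambda>i. norm (f x - s i x)) \<longlonglongrightarrow> 0" by simp
      qed
      show "AE x in lborel. norm (norm (f x - s i x)) \<le> 3 * norm (f x)" for i
      proof (rule AE_I2)
        fix x
        have "norm (f x - s i x) \<le> norm (f x) + norm (s i x)" by (rule norm_triangle_ineq4)
        with lim.hyps(3)[of x i] show "norm (norm (f x - s i x)) \<le> 3 * norm (f x)" by simp
      qed
    qed (use lim.hyps(1,4) in \<open>auto\<close>)
    from LIMSEQ_D[OF this \<open>e > 0\<close>] obtain i where "(LINT x|lborel. norm (f x - s i x)) < e"
      by auto
    then show "\<exists>g. integrable lborel g \<and> (LINT x|lborel. norm (f x - g x)) < e \<and>
      (\<lambda>n. LINT x|lborel. norm (g (x - X n) - g x)) \<longlonglongrightarrow> 0"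
      using lim.hyps(1) lim.IH by (intro exI[of _ "s i"]) auto
  qed
qed

section \<open>Fourier transform and convolution\<close>

text \<open>Unnormalised and with the positive sign, as for characteristic functions: convolution
  then becomes multiplication without a constant, and the L1 norm bounds the transform. The factor
  \<open>2 * pi\<close> reappears in the inversion formula.\<close>

definition fourier :: "(real \<Rightarrow> complex) \<Rightarrow> real \<Rightarrow> complex" where
  "fourier f y = (LINT x|lborel. f x * cis (x * y))"

lemma borel_measurable_cis [measurable]: "cis \<in> borel_measurable borel"
  by (intro borel_measurable_continuous_onI continuous_intros)

lemma integrable_mult_bounded:
  fixes f h :: "'a \<Rightarrow> 'b::{real_normed_field, banach, second_countable_topology}"
  assumes f: "integrable M f" and h: "h \<in> borel_measurable M" and bound: "\<And>x. norm (h x) \<le> B"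
  shows "integrable M (\<lambda>x. f x * h x)"
proof (rule Bochner_Integration.integrable_bound)
  show "integrable M (\<lambda>x. B * norm (f x))" using f by simp
  show "AE x in M. norm (f x * h x) \<le> norm (B * norm (f x))"
  proof (rule AE_I2)
    fix x
    have "0 \<le> B" using bound[of x] norm_ge_zero order_trans by blast
    then show "norm (f x * h x) \<le> norm (B * norm (f x))"
      using bound[of x] by (simp add: norm_mult mult.commute[of B] mult_left_mono)
  qed
qed (use f h in measurable)

lemma integrable_mult_cis:
  assumes "integrable lborel f"
  shows "integrable lborel (\<lambda>x. f x * cis (x * y))"
  by (rule integrable_mult_bounded[OF assms, where B = 1]) auto

lemma L1_norm_nonneg: "0 \<le> L1_norm f"
  unfolding L1_norm_def by (rule Bochner_Integration.integral_nonneg) simp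

lemma norm_fourier_le: "norm (fourier f y) \<le> L1_norm f"
proof -
  have "norm (fourier f y) \<le> (LINT x|lborel. norm (f x * cis (x * y)))"
    unfolding fourier_def by (rule integral_norm_bound)
  then show ?thesis by (simp add: L1_norm_def norm_mult)
qed

lemma fourier_add:
  assumes "integrable lborel f" "integrable lborel g"
  shows "fourier (\<lambda>x. f x + g x) y = fourier f y + fourier g y"
  unfolding fourier_def using assms[THEN integrable_mult_cis]
  by (simp add: distrib_right)

lemma fourier_diff:
  assumes "integrable lborel f" "integrable lborel g"
  shows "fourier (\<lambda>x. f x - g x) y = fourier f y - fourier g y"
  unfolding fourier_def using assms[THEN integrable_mult_cis]
  by (simp add: left_diff_distrib)

lemma fourier_cmult: "fourier (\<lambda>x. c * f x) y = c * fourier f y"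
  unfolding fourier_def by (simp add: mult.assoc)

lemma fourier_cong_AE:
  assumes "AE x in lborel. f x = g x" "f \<in> borel_measurable lborel" "g \<in> borel_measurable lborel"
  shows "fourier f y = fourier g y"
  unfolding fourier_def using assms by (intro integral_cong_AE) auto

lemma fourier_reflect: "fourier (\<lambda>x. f (- x)) y = fourier f (- y)"
  unfolding fourier_def
  using integral_reflect[of "\<lambda>x. f x * cis (x * - y)" 0] by simp

lemma isCont_fourier:
  assumes f: "integrable lborel f"
  shows "isCont (fourier f) y"
  unfolding isCont_def
proof (rule tendsto_at_iff_sequentially[THEN iffD2], intro allI impI)
  fix X assume X: "X \<longlonglongrightarrow> y"
  show "(fourier f \<circ> X) \<longlonglongrightarrow> fourier f y"
    unfolding fourier_def comp_def
  proof (rule integral_dominated_convergence[where w = "\<lambda>x. norm (f x)"])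
    have "(\<lambda>i. f x * cis (x * X i)) \<longlonglongrightarrow> f x * cis (x * y)" for x
      by (intro tendsto_intros X isCont_tendsto_compose[of _ cis] continuous_intros)
    then show "AE x in lborel. (\<lambda>i. f x * cis (x * X i)) \<longlonglongrightarrow> f x * cis (x * y)" by simp
  qed (use f in \<open>auto simp: norm_mult\<close>)
qed

lemma borel_measurable_fourier:
  assumes "integrable lborel f"
  shows "fourier f \<in> borel_measurable lborel"
  using isCont_fourier[OF assms]
  by (auto intro!: borel_measurable_continuous_onI continuous_at_imp_continuous_on)

section \<open>Convolution and the multiplication formula\<close>

definition convol :: "(real \<Rightarrow> complex) \<Rightarrow> (real \<Rightarrow> complex) \<Rightarrow> real \<Rightarrow> complex" where
  "convol f g x = (LINT u|lborel. f (x - u) * g u)"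

text \<open>Integrated in \<open>x\<close> first, the norm becomes a constant, the L1 norm of
  \<open>f\<close>, times \<open>norm (g u)\<close>. Therefore Fubini's criterion is checked in the
  order \<open>(u, x)\<close> and the variables are swapped afterwards.\<close>

lemma integrable_convol_pair:
  fixes f g :: "real \<Rightarrow> complex"
  assumes f: "integrable lborel f" and g: "integrable lborel g"
  shows "integrable (lborel \<Otimes>\<^sub>M lborel) (\<lambda>(x, u). f (x - u) * g u)"
proof -
  have [measurable]: "f \<in> borel_measurable borel" "g \<in> borel_measurable borel"
    using f g by (auto dest: borel_measurable_integrable)
  have "integrable (lborel \<Otimes>\<^sub>M lborel) (\<lambda>(u, x). f (x - u) * g u)"
  proof (rule lborel_pair.Fubini_integrable)
    have "(\<lambda>u. LINT x|lborel. norm (f (x - u)) * norm (g u)) = (\<lambda>u. (LINT x|lborel. norm (f x)) * norm (g u))"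
      using integral_translate[of "\<lambda>x. norm (f x)"] by simp
    then show "integrable lborel (\<lambda>u. LINT x|lborel. norm (case (u, x) of (u, x) \<Rightarrow> f (x - u) * g u))"
      using g by (simp add: norm_mult)
    show "AE u in lborel. integrable lborel (\<lambda>x. case (u, x) of (u, x) \<Rightarrow> f (x - u) * g u)"
      using integrable_translate[OF f] by simp
  qed measurable
  from lborel_pair.integrable_product_swap[OF this] show ?thesis by simp
qed

lemma integrable_convol:
  assumes "integrable lborel f" "integrable lborel g"
  shows "integrable lborel (convol f g)"
  using lborel_pair.integrable_fst'[OF integrable_convol_pair[OF assms]]
  by (simp add: convol_def[abs_def])

lemma L1_norm_convol_le:
  assumes f: "integrable lborel f" and g: "integrable lborel g"
  shows "L1_norm (convol f g) \<le> L1_norm f * L1_norm g"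
proof -
  have int: "integrable (lborel \<Otimes>\<^sub>M lborel) (\<lambda>(x, u). norm (f (x - u) * g u))"
    using integrable_norm[OF integrable_convol_pair[OF f g]] by (simp add: split_beta')
  have "L1_norm (convol f g) \<le> (LINT x|lborel. LINT u|lborel. norm (f (x - u) * g u))"
    unfolding L1_norm_def
  proof (rule integral_mono)
    show "norm (convol f g x) \<le> (LINT u|lborel. norm (f (x - u) * g u))" for x
      unfolding convol_def by (rule integral_norm_bound)
    show "integrable lborel (\<lambda>x. LINT u|lborel. norm (f (x - u) * g u))"
      using lborel_pair.integrable_fst'[OF int] by simp
  qed (use integrable_convol[OF f g] in auto)
  also have "\<dots> = (LINT u|lborel. LINT x|lborel. norm (f (x - u) * g u))"
    using lborel_pair.Fubini_integral[OF int] by simp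
  also have "\<dots> = (LINT u|lborel. L1_norm f * norm (g u))"
    using integral_translate[of "\<lambda>x. norm (f x)"] by (simp add: norm_mult L1_norm_def)
  finally show ?thesis by (simp add: L1_norm_def)
qed

lemma fourier_convol:
  assumes f: "integrable lborel f" and g: "integrable lborel g"
  shows "fourier (convol f g) y = fourier f y * fourier g y"
proof -
  have int: "integrable (lborel \<Otimes>\<^sub>M lborel) (\<lambda>(x, u). f (x - u) * g u * cis (x * y))"
  proof -
    have "integrable (lborel \<Otimes>\<^sub>M lborel) (\<lambda>p. (case p of (x, u) \<Rightarrow> f (x - u) * g u) * cis (fst p * y))"
      by (rule integrable_mult_bounded[OF integrable_convol_pair[OF f g], where B = 1]) auto
    then show ?thesis by (simp add: split_beta')
  qed
  have "fourier (convol f g) y = (LINT x|lborel. LINT u|lborel. f (x - u) * g u * cis (x * y))"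
    by (simp add: fourier_def convol_def)
  also have "\<dots> = (LINT u|lborel. LINT x|lborel. f (x - u) * g u * cis (x * y))"
    using lborel_pair.Fubini_integral[OF int] by simp
  also have "\<dots> = (LINT u|lborel. fourier f y * (g u * cis (u * y)))"
  proof (rule Bochner_Integration.integral_cong[OF refl])
    fix u
    have split: "cis (x * y) = cis ((x - u) * y) * cis (u * y)" for x
      by (simp add: cis_mult left_diff_distrib)
    have "(LINT x|lborel. f (x - u) * g u * cis (x * y))
        = (LINT x|lborel. f (x - u) * cis ((x - u) * y) * (g u * cis (u * y)))"
      by (intro Bochner_Integration.integral_cong refl) (subst split, simp only: mult_ac)
    also have "\<dots> = (LINT x|lborel. f (x - u) * cis ((x - u) * y)) * (g u * cis (u * y))"
      by simp
    also have "(LINT x|lborel. f (x - u) * cis ((x - u) * y)) = fourier f y"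
      unfolding fourier_def by (rule integral_translate)
    finally show "(LINT x|lborel. f (x - u) * g u * cis (x * y)) = fourier f y * (g u * cis (u * y))" .
  qed
  finally show ?thesis by (simp add: fourier_def)
qed

text \<open>Fubini for \<open>f x * cis (x * y) * g y\<close>. With a Gaussian as \<open>g\<close>,
  whose transform is explicit, it turns integrals of \<open>fourier f\<close> into mollified values
  of \<open>f\<close>; injectivity and inversion both rest on this.\<close>

lemma fourier_duality:
  assumes f: "integrable lborel f" and g: "integrable lborel g"
  shows "(LINT y|lborel. fourier f y * g y) = (LINT x|lborel. f x * fourier g x)"
proof -
  have [measurable]: "f \<in> borel_measurable borel" "g \<in> borel_measurable borel"
    using f g by (auto dest: borel_measurable_integrable)
  have "integrable (lborel \<Otimes>\<^sub>M lborel) (\<lambda>(x, y). f x * cis (x * y) * g y)"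
  proof (rule lborel_pair.Fubini_integrable)
    show "integrable lborel (\<lambda>x. LINT y|lborel. norm (case (x, y) of (x, y) \<Rightarrow> f x * cis (x * y) * g y))"
      using f by (simp add: norm_mult)
    have "integrable lborel (\<lambda>y. f x * (g y * cis (y * x)))" for x
      using integrable_mult_cis[OF g, of x] by simp
    then show "AE x in lborel. integrable lborel (\<lambda>y. case (x, y) of (x, y) \<Rightarrow> f x * cis (x * y) * g y)"
      by (simp add: mult_ac)
  qed measurable
  from lborel_pair.Fubini_integral[OF this]
  have "(LINT y|lborel. LINT x|lborel. f x * cis (x * y) * g y)
      = (LINT x|lborel. LINT y|lborel. f x * cis (x * y) * g y)" by simp
  moreover have "(LINT y|lborel. f x * cis (x * y) * g y) = f x * fourier g x" for x
    by (simp add: fourier_def mult_ac flip: integral_mult_right_zero)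
  ultimately show ?thesis by (simp add: fourier_def)
qed

section \<open>Gaussian mollifiers and Fourier inversion\<close>

lemma integrable_std_normal_density: "integrable lborel std_normal_density"
  using integrable_std_normal_moment[of 0] by simp

lemma integral_std_normal_density: "(LINT x|lborel. std_normal_density x) = 1"
  using integral_std_normal_moment_even[of 0] by simp

lemma fourier_std_normal_density:
  "fourier (\<lambda>x. complex_of_real (std_normal_density x)) y = complex_of_real (exp (- y\<^sup>2 / 2))"
proof -
  have "fourier (\<lambda>x. complex_of_real (std_normal_density x)) y
      = (LINT x|lborel. std_normal_density x *\<^sub>R iexp (y * x))"
    unfolding fourier_def
    by (intro Bochner_Integration.integral_cong) (simp_all add: scaleR_conv_of_real cis_conv_exp mult_ac)
  also have "\<dots> = char std_normal_distribution y"
    unfolding char_def by (subst integral_density) (auto simp: normal_density_nonneg)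
  finally show ?thesis by (simp add: char_std_normal_distribution)
qed

text \<open>For \<open>s > 0\<close> this is the density of the centred normal law with standard
  deviation \<open>1 / s\<close>; large \<open>s\<close> means concentration at 0.\<close>

definition gauss_mollifier :: "real \<Rightarrow> real \<Rightarrow> complex" where
  "gauss_mollifier s x = complex_of_real (s * std_normal_density (s * x))"

lemma integrable_gauss_mollifier:
  assumes "s > 0"
  shows "integrable lborel (gauss_mollifier s)"
  unfolding gauss_mollifier_def
  using lborel_integrable_real_affine[OF integrable_std_normal_density, of s 0] assms
  by (intro integrable_of_real integrable_mult_right) simp

lemma fourier_gauss_mollifier:
  assumes "s > 0"
  shows "fourier (gauss_mollifier s) y = complex_of_real (exp (- (y / s)\<^sup>2 / 2))"
proof -
  have "complex_of_real (exp (- (y / s)\<^sup>2 / 2))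
      = (LINT x|lborel. complex_of_real (std_normal_density x) * cis (x * (y / s)))"
    using fourier_std_normal_density[of "y / s"] by (simp add: fourier_def)
  also have "\<dots> = s *\<^sub>R (LINT x|lborel. complex_of_real (std_normal_density (s * x)) * cis (s * x * (y / s)))"
    using assms lborel_integral_real_affine[of s "\<lambda>x. complex_of_real (std_normal_density x) * cis (x * (y / s))" 0]
    by simp
  also have "\<dots> = (LINT x|lborel. s *\<^sub>R (complex_of_real (std_normal_density (s * x)) * cis (s * x * (y / s))))"
    by simp
  also have "\<dots> = fourier (gauss_mollifier s) y"
    unfolding fourier_def gauss_mollifier_def using assms
    by (intro Bochner_Integration.integral_cong) (simp_all add: scaleR_conv_of_real mult_ac)
  finally show ?thesis by simp
qed

lemma exp_gauss_conv_mollifier: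
  assumes "s > 0"
  shows "complex_of_real (exp (- (x / s)\<^sup>2 / 2))
    = complex_of_real (s * sqrt (2 * pi)) * gauss_mollifier (1 / s) x"
  using assms by (simp add: gauss_mollifier_def std_normal_density_def)

lemma integrable_exp_gauss:
  assumes "s > 0"
  shows "integrable lborel (\<lambda>x. complex_of_real (exp (- (x / s)\<^sup>2 / 2)))"
  unfolding exp_gauss_conv_mollifier[OF assms]
  using assms by (intro integrable_mult_right integrable_gauss_mollifier) simp

text \<open>Multiplication by \<open>cis (x * t)\<close> shifts the transform, and a wide Gaussian
  transforms into a narrow one. This is the test function to be put into
  \<open>fourier_duality\<close>.\<close>

lemma fourier_exp_gauss_cis:
  assumes s: "s > 0"
  shows "fourier (\<lambda>x. complex_of_real (exp (- (x / s)\<^sup>2 / 2)) * cis (x * t)) y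
    = complex_of_real (2 * pi) * gauss_mollifier s (t + y)"
proof -
  have "fourier (\<lambda>x. complex_of_real (exp (- (x / s)\<^sup>2 / 2)) * cis (x * t)) y
      = fourier (\<lambda>x. complex_of_real (exp (- (x / s)\<^sup>2 / 2))) (t + y)"
    unfolding fourier_def by (simp add: mult.assoc cis_mult distrib_left)
  also have "\<dots> = complex_of_real (s * sqrt (2 * pi)) * fourier (gauss_mollifier (1 / s)) (t + y)"
    unfolding exp_gauss_conv_mollifier[OF s] by (rule fourier_cmult)
  also have "\<dots> = complex_of_real (s * sqrt (2 * pi)) * complex_of_real (exp (- (s * (t + y))\<^sup>2 / 2))"
    using s by (simp add: fourier_gauss_mollifier mult.commute)
  also have "\<dots> = complex_of_real (2 * pi) * gauss_mollifier s (t + y)"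
  proof -
    have "sqrt (2 * pi) * sqrt (2 * pi) = 2 * pi" by simp
    then have "s * sqrt (2 * pi) * e = 2 * pi * (s * (1 / sqrt (2 * pi) * e))" for e :: real
      by (simp add: field_simps del: real_sqrt_mult_self real_sqrt_mult)
    then show ?thesis
      unfolding gauss_mollifier_def std_normal_density_def of_real_mult[symmetric] by simp
  qed
  finally show ?thesis .
qed

text \<open>The substitution \<open>u = v / s\<close> moves the scale from the weight into the
  argument of \<open>h\<close>, so that the weight stays fixed when dominated convergence is applied
  for growing \<open>s\<close>.\<close>

lemma integral_gauss_mollifier_mult:
  fixes h :: "real \<Rightarrow> complex"
  assumes s: "s > 0"
  shows "(LINT u|lborel. h u * gauss_mollifier s u)
    = (LINT v|lborel. h (v / s) * complex_of_real (std_normal_density v))"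
proof -
  have "(LINT v|lborel. h (v / s) * complex_of_real (std_normal_density v))
      = s *\<^sub>R (LINT u|lborel. h u * complex_of_real (std_normal_density (s * u)))"
    using s lborel_integral_real_affine[of s "\<lambda>v. h (v / s) * complex_of_real (std_normal_density v)" 0]
    by simp
  also have "\<dots> = (LINT u|lborel. s *\<^sub>R (h u * complex_of_real (std_normal_density (s * u))))"
    by simp
  also have "\<dots> = (LINT u|lborel. h u * gauss_mollifier s u)"
    by (intro Bochner_Integration.integral_cong) (simp_all add: gauss_mollifier_def scaleR_conv_of_real mult_ac)
  finally show ?thesis by simp
qed

lemma L1_norm_translate_diff_le:
  assumes f: "integrable lborel f"
  shows "(LINT x|lborel. norm (f (x - t) - f x)) \<le> 2 * L1_norm f"
proof -
  have "(LINT x|lborel. norm (f (x - t) - f x)) \<le> (LINT x|lborel. norm (f (x - t)) + norm (f x))"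
    using f integrable_translate[OF f] by (intro integral_mono norm_triangle_ineq4) auto
  also have "\<dots> = (LINT x|lborel. norm (f (x - t))) + L1_norm f"
    unfolding L1_norm_def using f integrable_translate[OF f]
    by (intro Bochner_Integration.integral_add) auto
  also have "(LINT x|lborel. norm (f (x - t))) = L1_norm f"
    unfolding L1_norm_def by (rule integral_translate)
  finally show ?thesis by simp
qed

text \<open>Minkowski's integral inequality: as the density has mass 1,
  \<open>convol f (gauss_mollifier s) x - f x\<close> is the average of
  \<open>f (x - v / s) - f x\<close> over \<open>v\<close>, and the norm may be taken
  inside.\<close>

lemma L1_norm_convol_mollifier_diff_le:
  assumes f: "integrable lborel f" and s: "s > 0"
  shows "L1_norm (\<lambda>x. convol f (gauss_mollifier s) x - f x)
    \<le> (LINT v|lborel. (LINT x|lborel. norm (f (x - v / s) - f x)) * std_normal_density v)"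
proof -
  have [measurable]: "f \<in> borel_measurable borel"
    using f by (auto dest: borel_measurable_integrable)
  let ?F = "\<lambda>x v. (f (x - v / s) - f x) * complex_of_real (std_normal_density v)"
  let ?w = "\<lambda>v. LINT x|lborel. norm (f (x - v / s) - f x)"
  have int': "integrable (lborel \<Otimes>\<^sub>M lborel) (\<lambda>(v, x). ?F x v)"
  proof (rule lborel_pair.Fubini_integrable)
    show "integrable lborel (\<lambda>v. LINT x|lborel. norm (case (v, x) of (v, x) \<Rightarrow> ?F x v))"
    proof (rule Bochner_Integration.integrable_bound)
      show "integrable lborel (\<lambda>v. 2 * L1_norm f * std_normal_density v)"
        using integrable_std_normal_density by simp
      show "AE v in lborel. norm (LINT x|lborel. norm (case (v, x) of (v, x) \<Rightarrow> ?F x v))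
          \<le> norm (2 * L1_norm f * std_normal_density v)"
        using L1_norm_translate_diff_le[OF f] L1_norm_nonneg[of f]
        by (intro AE_I2) (simp add: norm_mult abs_mult normal_density_nonneg mult_right_mono)
    qed measurable
    show "AE v in lborel. integrable lborel (\<lambda>x. case (v, x) of (v, x) \<Rightarrow> ?F x v)"
      using f integrable_translate[OF f] by (intro AE_I2) simp
  qed measurable
  have int: "integrable (lborel \<Otimes>\<^sub>M lborel) (\<lambda>(x, v). norm (?F x v))"
    using integrable_norm[OF lborel_pair.integrable_product_swap[OF int']] by (simp add: split_beta')
  \<comment> \<open>Splitting off \<open>f x\<close> uses integrability of the section in
    \<open>v\<close>, which Fubini's theorem gives for almost every \<open>x\<close>.\<close>
  have eq: "AE x in lborel. convol f (gauss_mollifier s) x - f x = (LINT v|lborel. ?F x v)"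
    using lborel_pair.AE_integrable_fst'[OF lborel_pair.integrable_product_swap[OF int']]
  proof eventually_elim
    fix x assume "integrable lborel (\<lambda>y. case (x, y) of (x, y) \<Rightarrow> case (y, x) of (v, x) \<Rightarrow> ?F x v)"
    then have "integrable lborel (?F x)" by simp
    then have i: "integrable lborel (\<lambda>v. ?F x v + f x * complex_of_real (std_normal_density v))"
      using integrable_std_normal_density by (intro Bochner_Integration.integrable_add) auto
    have "convol f (gauss_mollifier s) x = (LINT v|lborel. ?F x v + f x * complex_of_real (std_normal_density v))"
      unfolding convol_def integral_gauss_mollifier_mult[OF s] by (simp add: algebra_simps)
    also have "\<dots> = (LINT v|lborel. ?F x v) + (LINT v|lborel. f x * complex_of_real (std_normal_density v))"
      using \<open>integrable lborel (?F x)\<close> integrable_std_normal_density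
      by (intro Bochner_Integration.integral_add) auto
    also have "(LINT v|lborel. f x * complex_of_real (std_normal_density v)) = f x"
      by (simp add: integral_std_normal_density)
    finally show "convol f (gauss_mollifier s) x - f x = (LINT v|lborel. ?F x v)" by simp
  qed
  have intc: "integrable lborel (\<lambda>x. convol f (gauss_mollifier s) x - f x)"
    using integrable_convol[OF f integrable_gauss_mollifier[OF s]] f by simp
  have "L1_norm (\<lambda>x. convol f (gauss_mollifier s) x - f x) \<le> (LINT x|lborel. LINT v|lborel. norm (?F x v))"
    unfolding L1_norm_def
  proof (rule integral_mono_AE)
    show "AE x in lborel. norm (convol f (gauss_mollifier s) x - f x) \<le> (LINT v|lborel. norm (?F x v))"
      using eq by eventually_elim (metis integral_norm_bound)
    show "integrable lborel (\<lambda>x. LINT v|lborel. norm (?F x v))"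
      using lborel_pair.integrable_fst'[OF int] by simp
  qed (use intc in auto)
  also have "\<dots> = (LINT v|lborel. LINT x|lborel. norm (?F x v))"
    using lborel_pair.Fubini_integral[OF int] by simp
  also have "\<dots> = (LINT v|lborel. ?w v * std_normal_density v)"
    by (simp add: norm_mult normal_density_nonneg)
  finally show ?thesis .
qed

text \<open>For fixed \<open>v\<close> the shift \<open>v / real (Suc n)\<close> tends to 0, so
  continuity of translation applies; twice the norm of \<open>f\<close> times the density dominates.
  The index \<open>Suc n\<close> keeps the scale positive.\<close>

lemma convol_gauss_mollifier_tendsto:
  assumes f: "integrable lborel f"
  shows "(\<lambda>n. L1_norm (\<lambda>x. convol f (gauss_mollifier (real (Suc n))) x - f x)) \<longlonglongrightarrow> 0"
proof (rule tendsto_sandwich[OF _ _ tendsto_const])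
  have [measurable]: "f \<in> borel_measurable borel"
    using f by (auto dest: borel_measurable_integrable)
  let ?w = "\<lambda>t. LINT x|lborel. norm (f (x - t) - f x)"
  have "(\<lambda>n. LINT v|lborel. ?w (v / real (Suc n)) * std_normal_density v) \<longlonglongrightarrow> (LINT v|(lborel::real measure). (0::real))"
  proof (rule integral_dominated_convergence[where w = "\<lambda>v. 2 * L1_norm f * std_normal_density v"])
    have "(\<lambda>n. ?w (v / real (Suc n)) * std_normal_density v) \<longlonglongrightarrow> 0" for v
    proof -
      have "(\<lambda>n. v / real (Suc n)) \<longlonglongrightarrow> 0"
        using LIMSEQ_Suc[OF lim_const_over_n[of v]] by simp
      from tendsto_mult_right[OF translation_tendsto_L1[OF f this], of "std_normal_density v"]
      show ?thesis by simp
    qed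
    then show "AE v in lborel. (\<lambda>n. ?w (v / real (Suc n)) * std_normal_density v) \<longlonglongrightarrow> 0" by simp
    show "AE v in lborel. norm (?w (v / real (Suc n)) * std_normal_density v) \<le> 2 * L1_norm f * std_normal_density v" for n
      using L1_norm_translate_diff_le[OF f]
      by (intro AE_I2) (simp add: abs_mult normal_density_nonneg mult_right_mono)
    show "integrable lborel (\<lambda>v. 2 * L1_norm f * std_normal_density v)"
      using integrable_std_normal_density by simp
  qed measurable
  then show "(\<lambda>n. LINT v|lborel. ?w (v / real (Suc n)) * std_normal_density v) \<longlonglongrightarrow> 0" by simp
qed (use L1_norm_convol_mollifier_diff_le[OF f] L1_norm_nonneg in \<open>auto intro!: always_eventually\<close>)

section \<open>Injectivity of the transform and Fourier inversion\<close>

lemma L1_norm_eq_0_iff: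
  assumes "integrable lborel f"
  shows "L1_norm f = 0 \<longleftrightarrow> (AE x in lborel. f x = 0)"
  unfolding L1_norm_def using assms by (subst integral_nonneg_eq_0_iff_AE) auto

text \<open>By duality with modulated Gaussians every mollification of \<open>f\<close> vanishes
  identically; since these converge to \<open>f\<close> in L1, the norm of \<open>f\<close> is
  0.\<close>

lemma fourier_eq_0_imp_AE:
  assumes f: "integrable lborel f" and zero: "\<And>y. fourier f y = 0"
  shows "AE x in lborel. f x = 0"
proof -
  have "convol f (gauss_mollifier s) x = 0" if s: "s > 0" for s x
  proof -
    \<comment> \<open>Modulation by \<open>- x\<close> centres the transformed Gaussian at
      \<open>x\<close>; pairing it with \<open>f\<close> gives \<open>2 * pi\<close> times the
      mollified value at \<open>x\<close>.\<close>
    let ?g = "\<lambda>y. complex_of_real (exp (- (y / s)\<^sup>2 / 2)) * cis (y * (-x))"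
    have g: "integrable lborel ?g"
      using integrable_exp_gauss[OF s] by (rule integrable_mult_cis)
    have sym: "gauss_mollifier s (-x + u) = gauss_mollifier s (x - u)" for u
      unfolding gauss_mollifier_def std_normal_density_def by (simp add: power2_commute algebra_simps power2_eq_square)
    have "0 = (LINT u|lborel. f u * (complex_of_real (2 * pi) * gauss_mollifier s (x - u)))"
      using fourier_duality[OF f g] unfolding fourier_exp_gauss_cis[OF s] zero sym by simp
    also have "\<dots> = (LINT u|lborel. complex_of_real (2 * pi) * (f u * gauss_mollifier s (x - u)))"
      by (simp only: mult_ac)
    also have "\<dots> = complex_of_real (2 * pi) * (LINT u|lborel. f u * gauss_mollifier s (x - u))"
      by (rule integral_mult_right_zero)
    finally have "(LINT u|lborel. f u * gauss_mollifier s (x - u)) = 0" by simp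
    moreover have "(LINT u|lborel. f u * gauss_mollifier s (x - u)) = convol f (gauss_mollifier s) x"
      unfolding convol_def using integral_reflect[of "\<lambda>u. f u * gauss_mollifier s (x - u)" x] by simp
    ultimately show ?thesis by simp
  qed
  then have "(\<lambda>n::nat. L1_norm (\<lambda>x. - f x)) \<longlonglongrightarrow> 0"
    using convol_gauss_mollifier_tendsto[OF f] by simp
  then have "L1_norm f = 0"
    by (simp add: L1_norm_def LIMSEQ_const_iff)
  then show ?thesis using L1_norm_eq_0_iff[OF f] by simp
qed

lemma fourier_inject:
  assumes f: "integrable lborel f" and g: "integrable lborel g" and eq: "\<And>y. fourier f y = fourier g y"
  shows "AE x in lborel. f x = g x"
proof -
  have "AE x in lborel. f x - g x = 0"
    using f g eq by (intro fourier_eq_0_imp_AE) (auto simp: fourier_diff)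
  then show ?thesis by simp
qed

text \<open>A Gaussian factor tending to 1 is inserted into the double transform. Dominated
  convergence removes it in the limit, while duality rewrites each integral as a mollification of
  \<open>Q\<close> at \<open>- y\<close>, which tends to the value there since \<open>Q\<close> is
  continuous and bounded.\<close>

lemma fourier_inversion:
  assumes Q: "integrable lborel Q" and cont: "\<And>y. isCont Q y" and bound: "\<And>y. norm (Q y) \<le> B"
    and q: "integrable lborel (fourier Q)"
  shows "fourier (fourier Q) y = complex_of_real (2 * pi) * Q (- y)"
proof (rule LIMSEQ_unique)
  let ?g = "\<lambda>n x. complex_of_real (exp (- (x / real (Suc n))\<^sup>2 / 2))"
  have [measurable]: "Q \<in> borel_measurable borel"
    using Q by (auto dest: borel_measurable_integrable)
  have [measurable]: "fourier Q \<in> borel_measurable borel"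
    using borel_measurable_fourier[OF Q] by simp
  show "(\<lambda>n. LINT x|lborel. fourier Q x * (?g n x * cis (x * y))) \<longlonglongrightarrow> fourier (fourier Q) y"
    unfolding fourier_def[of "fourier Q"]
  proof (rule integral_dominated_convergence[where w = "\<lambda>x. norm (fourier Q x)"])
    have "(\<lambda>n. fourier Q x * (?g n x * cis (x * y))) \<longlonglongrightarrow> fourier Q x * (complex_of_real (exp (- 0\<^sup>2 / 2)) * cis (x * y))" for x
      by (intro tendsto_intros) (use LIMSEQ_Suc[OF lim_const_over_n[of x]] in auto)
    then show "AE x in lborel. (\<lambda>n. fourier Q x * (?g n x * cis (x * y))) \<longlonglongrightarrow> fourier Q x * cis (x * y)" by simp
    show "AE x in lborel. norm (fourier Q x * (?g n x * cis (x * y))) \<le> norm (fourier Q x)" for n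
      by (intro AE_I2) (simp add: norm_mult mult_left_le)
  qed (use q in \<open>auto intro!: borel_measurable_fourier\<close>)
  have "(LINT x|lborel. fourier Q x * (?g n x * cis (x * y)))
      = complex_of_real (2 * pi) * (LINT v|lborel. Q (v / real (Suc n) - y) * complex_of_real (std_normal_density v))" for n
  proof -
    have s: "real (Suc n) > 0" by simp
    have "(LINT x|lborel. fourier Q x * (?g n x * cis (x * y)))
        = (LINT u|lborel. Q u * (complex_of_real (2 * pi) * gauss_mollifier (real (Suc n)) (y + u)))"
      using fourier_duality[OF Q integrable_mult_cis[OF integrable_exp_gauss[OF s], of y]]
      unfolding fourier_exp_gauss_cis[OF s] .
    also have "\<dots> = (LINT u|lborel. complex_of_real (2 * pi) * (Q u * gauss_mollifier (real (Suc n)) (y + u)))"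
      by (simp only: mult_ac)
    also have "\<dots> = complex_of_real (2 * pi) * (LINT u|lborel. Q u * gauss_mollifier (real (Suc n)) (y + u))"
      by (rule integral_mult_right_zero)
    also have "(LINT u|lborel. Q u * gauss_mollifier (real (Suc n)) (y + u))
        = (LINT u|lborel. Q (u - y) * gauss_mollifier (real (Suc n)) u)"
      using integral_translate[of "\<lambda>u. Q u * gauss_mollifier (real (Suc n)) (y + u)" y] by simp
    also have "\<dots> = (LINT v|lborel. Q (v / real (Suc n) - y) * complex_of_real (std_normal_density v))"
      by (rule integral_gauss_mollifier_mult[OF s])
    finally show ?thesis .
  qed
  moreover have "(\<lambda>n. LINT v|lborel. Q (v / real (Suc n) - y) * complex_of_real (std_normal_density v))
      \<longlonglongrightarrow> (LINT v|lborel. Q (- y) * complex_of_real (std_normal_density v))"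
  proof (rule integral_dominated_convergence[where w = "\<lambda>v. B * std_normal_density v"])
    have "(\<lambda>n. Q (v / real (Suc n) - y) * complex_of_real (std_normal_density v))
        \<longlonglongrightarrow> Q (0 - y) * complex_of_real (std_normal_density v)" for v
      by (intro tendsto_intros isCont_tendsto_compose[of _ Q] cont)
         (use LIMSEQ_Suc[OF lim_const_over_n[of v]] in auto)
    then show "AE v in lborel. (\<lambda>n. Q (v / real (Suc n) - y) * complex_of_real (std_normal_density v))
        \<longlonglongrightarrow> Q (- y) * complex_of_real (std_normal_density v)" by simp
    show "AE v in lborel. norm (Q (v / real (Suc n) - y) * complex_of_real (std_normal_density v))
        \<le> B * std_normal_density v" for n
      using bound by (intro AE_I2) (simp add: norm_mult normal_density_nonneg mult_right_mono)
  qed (use integrable_std_normal_density in auto)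
  ultimately show "(\<lambda>n. LINT x|lborel. fourier Q x * (?g n x * cis (x * y)))
      \<longlonglongrightarrow> complex_of_real (2 * pi) * Q (- y)"
    by (simp add: integral_std_normal_density tendsto_mult_left)
qed

section \<open>Transforms of twice differentiable functions\<close>

lemma integral_derivative_eq_0:
  fixes F :: "real \<Rightarrow> complex"
  assumes F: "\<And>y. (F has_vector_derivative f y) (at y)" and cont: "\<And>y. isCont f y"
    and f: "integrable lborel f" and lim: "(F \<longlongrightarrow> 0) at_infinity"
  shows "(LINT y|lborel. f y) = 0"
proof -
  have "(LBINT y=-\<infinity>..\<infinity>. f y) = 0 - 0"
  proof (rule interval_integral_FTC_integrable)
    show "((F \<circ> real_of_ereal) \<longlongrightarrow> 0) (at_right (-\<infinity>))" "((F \<circ> real_of_ereal) \<longlongrightarrow> 0) (at_left \<infinity>)"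
      using tendsto_mono[OF at_bot_le_at_infinity lim] tendsto_mono[OF at_top_le_at_infinity lim]
      by (simp_all add: ereal_tendsto_simps)
  qed (use F cont f in \<open>auto simp: set_integrable_def einterval_eq_UNIV\<close>)
  then show ?thesis
    by (simp add: interval_lebesgue_integral_def set_lebesgue_integral_def einterval_eq_UNIV)
qed

lemma has_vector_derivative_isCont:
  "(f has_vector_derivative f') (at x) \<Longrightarrow> isCont f x"
  using has_vector_derivative_continuous by (auto simp: continuous_within)

lemma has_vector_derivative_cis_mult:
  "((\<lambda>y. cis (y * x)) has_vector_derivative \<i> * complex_of_real x * cis (y * x)) (at y)"
proof -
  have "((\<lambda>y. iexp (y * x)) has_vector_derivative x *\<^sub>R (\<i> * iexp (y * x))) (at y)"
    by (rule vector_diff_chain_at[of "\<lambda>y. y * x" x y iexp, unfolded comp_def])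
       (auto intro!: derivative_eq_intros has_vector_derivative_iexp simp flip: has_real_derivative_iff_has_vector_derivative)
  then show ?thesis by (simp add: cis_conv_exp scaleR_conv_of_real mult_ac)
qed

lemma integral_inverse_1_plus_square:
  "integrable lborel (\<lambda>x::real. 1 / (1 + x\<^sup>2))" "(LINT x|lborel. 1 / (1 + x\<^sup>2)) = pi"
  using integrable_inverse_1_plus_square LBINT_inverse_1_plus_square
  by (simp_all add: set_integrable_def interval_lebesgue_integral_def set_lebesgue_integral_def
      einterval_eq_UNIV inverse_eq_divide)

text \<open>Two integrations by parts at once: \<open>?F\<close> is a primitive of \<open>?f\<close>
  vanishing at infinity, so the transform of \<open>Q''\<close> is that of \<open>Q\<close> times
  \<open>- x\<^sup>2\<close>. Adding the trivial bounds for both transforms yields the factor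
  \<open>1 + x\<^sup>2\<close>.\<close>

lemma norm_fourier_C2_le:
  assumes D1: "\<And>y. (Q has_vector_derivative Q' y) (at y)" and D2: "\<And>y. (Q' has_vector_derivative Q'' y) (at y)"
    and cont: "\<And>y. isCont Q'' y" and Q: "integrable lborel Q" and Q'': "integrable lborel Q''"
    and lim: "(Q \<longlongrightarrow> 0) at_infinity" "(Q' \<longlongrightarrow> 0) at_infinity"
  shows "norm (fourier Q x) \<le> (L1_norm Q + L1_norm Q'') * (1 / (1 + x\<^sup>2))"
proof -
  let ?F = "\<lambda>y. (Q' y - \<i> * complex_of_real x * Q y) * cis (y * x)"
  let ?f = "\<lambda>y. (Q'' y + complex_of_real (x\<^sup>2) * Q y) * cis (y * x)"
  have int: "integrable lborel (\<lambda>y. Q'' y * cis (y * x))" "integrable lborel (\<lambda>y. complex_of_real (x\<^sup>2) * (Q y * cis (y * x)))"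
    using integrable_mult_cis[OF Q''] integrable_mult_cis[OF Q] by auto
  have "(LINT y|lborel. ?f y) = 0"
  proof (rule integral_derivative_eq_0)
    show "(?F has_vector_derivative ?f y) (at y)" for y
    proof -
      have "(?F has_vector_derivative (Q' y - \<i> * complex_of_real x * Q y) * (\<i> * complex_of_real x * cis (y * x)) +
          (Q'' y - \<i> * complex_of_real x * Q' y) * cis (y * x)) (at y)"
        by (intro has_vector_derivative_mult has_vector_derivative_diff has_vector_derivative_mult_right
            has_vector_derivative_cis_mult D1 D2)
      moreover have "(Q' y - \<i> * complex_of_real x * Q y) * (\<i> * complex_of_real x * cis (y * x)) +
          (Q'' y - \<i> * complex_of_real x * Q' y) * cis (y * x) = ?f y"
      proof -
        have "(p - \<i> * z * q) * (\<i> * z * c) + (r - \<i> * z * p) * c = (r + z\<^sup>2 * q) * c" for p q r z c :: complex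
          by (simp add: algebra_simps power2_eq_square)
        from this[of "Q' y" "complex_of_real x" "Q y" "cis (y * x)" "Q'' y"] show ?thesis by simp
      qed
      ultimately show ?thesis by simp
    qed
    show "isCont ?f y" for y
      using D1[THEN has_vector_derivative_isCont]
      by (intro continuous_intros cont has_vector_derivative_isCont[OF has_vector_derivative_cis_mult])
    show "integrable lborel ?f"
      using Bochner_Integration.integrable_add[OF int] by (simp add: distrib_right mult.assoc)
    have "((\<lambda>y. norm (Q' y) + \<bar>x\<bar> * norm (Q y)) \<longlongrightarrow> norm (0::complex) + \<bar>x\<bar> * norm (0::complex)) at_infinity"
      by (intro tendsto_intros lim)
    then have lim0: "((\<lambda>y. norm (Q' y) + \<bar>x\<bar> * norm (Q y)) \<longlongrightarrow> 0) at_infinity" by simp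
    show "(?F \<longlongrightarrow> 0) at_infinity"
    proof (rule Lim_null_comparison[OF _ lim0], rule always_eventually, rule allI)
      fix y
      show "norm (?F y) \<le> norm (Q' y) + \<bar>x\<bar> * norm (Q y)"
        using norm_triangle_ineq4[of "Q' y" "\<i> * complex_of_real x * Q y"] by (simp add: norm_mult)
    qed
  qed
  also have "(LINT y|lborel. ?f y) = fourier Q'' x + complex_of_real (x\<^sup>2) * fourier Q x"
    unfolding fourier_def using Bochner_Integration.integral_add[OF int]
    by (simp add: distrib_right mult.assoc)
  finally have "fourier Q'' x = - (complex_of_real (x\<^sup>2) * fourier Q x)"
    by (simp add: eq_neg_iff_add_eq_0)
  then have "norm (fourier Q'' x) = norm (complex_of_real (x\<^sup>2) * fourier Q x)"
    by simp
  also have "\<dots> = x\<^sup>2 * norm (fourier Q x)"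
    by (simp only: norm_mult norm_of_real) simp
  finally have "(1 + x\<^sup>2) * norm (fourier Q x) \<le> L1_norm Q + L1_norm Q''"
    using norm_fourier_le[of Q x] norm_fourier_le[of Q'' x] by (simp add: algebra_simps)
  then show ?thesis
    using sum_power2_gt_zero_iff[of 1 x] by (simp add: field_simps)
qed

section \<open>The algebra of transforms\<close>

text \<open>Membership in the Fourier algebra with norm at most \<open>C\<close>. Carrying the bound
  in the predicate lets functions be estimated without naming their preimages.\<close>

definition wiener_bound :: "(real \<Rightarrow> complex) \<Rightarrow> real \<Rightarrow> bool" where
  "wiener_bound \<phi> C \<longleftrightarrow> (\<exists>f. integrable lborel f \<and> (\<forall>y. fourier f y = \<phi> y) \<and> L1_norm f \<le> C)"

lemma wiener_boundI:
  "integrable lborel f \<Longrightarrow> (\<And>y. fourier f y = \<phi> y) \<Longrightarrow> L1_norm f \<le> C \<Longrightarrow> wiener_bound \<phi> C"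
  by (auto simp: wiener_bound_def)

lemma wiener_bound_mono: "wiener_bound \<phi> C \<Longrightarrow> C \<le> D \<Longrightarrow> wiener_bound \<phi> D"
  unfolding wiener_bound_def using order_trans by blast

lemma wiener_bound_norm_le: "wiener_bound \<phi> C \<Longrightarrow> norm (\<phi> y) \<le> C"
  unfolding wiener_bound_def using norm_fourier_le order_trans by metis

lemma wiener_bound_add:
  assumes "wiener_bound \<phi> C" "wiener_bound \<psi> D"
  shows "wiener_bound (\<lambda>y. \<phi> y + \<psi> y) (C + D)"
proof -
  from assms obtain f g where fg: "integrable lborel f" "\<And>y. fourier f y = \<phi> y" "L1_norm f \<le> C"
    "integrable lborel g" "\<And>y. fourier g y = \<psi> y" "L1_norm g \<le> D"
    unfolding wiener_bound_def by metis
  have "L1_norm (\<lambda>x. f x + g x) \<le> (LINT x|lborel. norm (f x) + norm (g x))"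
    unfolding L1_norm_def using fg by (intro integral_mono norm_triangle_ineq) auto
  also have "\<dots> = L1_norm f + L1_norm g"
    unfolding L1_norm_def using fg by simp
  finally show ?thesis
    using fg by (intro wiener_boundI[of "\<lambda>x. f x + g x"]) (auto simp: fourier_add)
qed

lemma wiener_bound_mult:
  assumes "wiener_bound \<phi> C" "wiener_bound \<psi> D"
  shows "wiener_bound (\<lambda>y. \<phi> y * \<psi> y) (C * D)"
proof -
  from assms obtain f g where fg: "integrable lborel f" "\<And>y. fourier f y = \<phi> y" "L1_norm f \<le> C"
    "integrable lborel g" "\<And>y. fourier g y = \<psi> y" "L1_norm g \<le> D"
    unfolding wiener_bound_def by metis
  have "L1_norm f * L1_norm g \<le> C * D"
    using fg L1_norm_nonneg[of f] L1_norm_nonneg[of g] by (intro mult_mono) auto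
  with L1_norm_convol_le[OF fg(1,4)] show ?thesis
    using fg by (intro wiener_boundI[of "convol f g"]) (auto simp: fourier_convol integrable_convol)
qed

lemma wiener_bound_cmult:
  assumes "wiener_bound \<phi> C"
  shows "wiener_bound (\<lambda>y. c * \<phi> y) (norm c * C)"
proof -
  from assms obtain f where f: "integrable lborel f" "\<And>y. fourier f y = \<phi> y" "L1_norm f \<le> C"
    unfolding wiener_bound_def by metis
  then show ?thesis
    by (intro wiener_boundI[of "\<lambda>x. c * f x"])
       (auto simp: fourier_cmult L1_norm_def norm_mult mult_left_mono)
qed

lemma wiener_bound_reflect:
  assumes "wiener_bound \<phi> C"
  shows "wiener_bound (\<lambda>y. \<phi> (- y)) C"
proof -
  from assms obtain f where f: "integrable lborel f" "\<And>y. fourier f y = \<phi> y" "L1_norm f \<le> C"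
    unfolding wiener_bound_def by metis
  then show ?thesis
    using integrable_reflect[of f 0] integral_reflect[of "\<lambda>x. norm (f x)" 0]
    by (intro wiener_boundI[of "\<lambda>x. f (- x)"]) (auto simp: fourier_reflect L1_norm_def)
qed

text \<open>Exponents start at 1 because the constant function 1 is not the transform of an
  integrable function.\<close>

lemma wiener_bound_power:
  assumes "wiener_bound \<phi> C"
  shows "wiener_bound (\<lambda>y. \<phi> y ^ Suc n) (C ^ Suc n)"
proof (induction n)
  case 0
  then show ?case using assms by simp
next
  case (Suc n)
  show ?case using wiener_bound_mult[OF assms Suc] by simp
qed

text \<open>Completeness of L1: preimages with summable norms can be summed almost everywhere, and
  the transform of the sum is taken term by term.\<close>

lemma wiener_bound_suminf:
  assumes bound: "\<And>n. wiener_bound (\<phi> n) (C n)" and C: "summable C"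
  shows "wiener_bound (\<lambda>y. \<Sum>n. \<phi> n y) (\<Sum>n. C n)"
proof -
  from bound obtain f where f: "\<And>n. integrable lborel (f n)" "\<And>n y. fourier (f n) y = \<phi> n y" "\<And>n. L1_norm (f n) \<le> C n"
    unfolding wiener_bound_def by metis
  have L1: "summable (\<lambda>n. L1_norm (f n))"
    using f(3) L1_norm_nonneg by (intro summable_comparison_test'[OF C]) auto
  \<comment> \<open>The sum of the norms has finite integral by monotone convergence, hence is
    finite almost everywhere.\<close>
  have AEs: "AE x in lborel. summable (\<lambda>n. norm (f n x))"
  proof -
    have "(\<integral>\<^sup>+x. (\<Sum>n. ennreal (norm (f n x))) \<partial>lborel) = (\<Sum>n. \<integral>\<^sup>+x. ennreal (norm (f n x)) \<partial>lborel)"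
      using f(1) by (intro nn_integral_suminf) auto
    also have "\<dots> = (\<Sum>n. ennreal (L1_norm (f n)))"
      using f(1) by (simp add: nn_integral_eq_integral L1_norm_def)
    also have "\<dots> \<noteq> \<infinity>"
      using L1 L1_norm_nonneg by (simp add: ennreal_suminf_neq_top)
    finally have "AE x in lborel. (\<Sum>n. ennreal (norm (f n x))) \<noteq> \<infinity>"
      using f(1) by (intro nn_integral_PInf_AE) auto
    then show ?thesis
      by eventually_elim (auto intro: summable_suminf_not_top)
  qed
  have int: "integrable lborel (\<lambda>x. \<Sum>n. f n x)"
    using f(1) AEs L1 by (intro integrable_suminf) (auto simp: L1_norm_def)
  have "L1_norm (\<lambda>x. \<Sum>n. f n x) \<le> (LINT x|lborel. (\<Sum>n. norm (f n x)))"
    unfolding L1_norm_def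
  proof (rule integral_mono_AE)
    show "AE x in lborel. norm (\<Sum>n. f n x) \<le> (\<Sum>n. norm (f n x))"
      using AEs by eventually_elim (rule summable_norm)
    show "integrable lborel (\<lambda>x. \<Sum>n. norm (f n x))"
      using f(1) AEs L1 by (intro integrable_suminf) (auto simp: L1_norm_def)
  qed (use int in auto)
  also have "\<dots> = (\<Sum>n. L1_norm (f n))"
    using f(1) AEs L1 unfolding L1_norm_def by (subst integral_suminf) auto
  also have "\<dots> \<le> (\<Sum>n. C n)"
    by (rule suminf_le[OF f(3) L1 C])
  finally have norm: "L1_norm (\<lambda>x. \<Sum>n. f n x) \<le> (\<Sum>n. C n)" .
  have "fourier (\<lambda>x. \<Sum>n. f n x) y = (\<Sum>n. \<phi> n y)" for y
  proof -
    have "fourier (\<lambda>x. \<Sum>n. f n x) y = (LINT x|lborel. (\<Sum>n. f n x * cis (x * y)))"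
      unfolding fourier_def
    proof (rule integral_cong_AE)
      show "AE x in lborel. (\<Sum>n. f n x) * cis (x * y) = (\<Sum>n. f n x * cis (x * y))"
        using AEs by eventually_elim (rule suminf_mult2, rule summable_norm_cancel)
    next
      have [measurable]: "f n \<in> borel_measurable lborel" for n
        using f(1) by (rule borel_measurable_integrable)
      show "(\<lambda>x. (\<Sum>n. f n x) * cis (x * y)) \<in> borel_measurable lborel"
        "(\<lambda>x. \<Sum>n. f n x * cis (x * y)) \<in> borel_measurable lborel" by measurable
    qed
    also have "\<dots> = (\<Sum>n. LINT x|lborel. f n x * cis (x * y))"
      using f(1) AEs L1 by (intro integral_suminf integrable_mult_cis) (auto simp: L1_norm_def norm_mult)
    finally show ?thesis using f(2) by (simp add: fourier_def)
  qed
  with int norm show ?thesis by (intro wiener_boundI)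
qed

text \<open>The transform of \<open>Q\<close> is bounded by a multiple of
  \<open>1 / (1 + x\<^sup>2)\<close>, whose integral is \<open>pi\<close>. It is therefore
  integrable, and by inversion \<open>Q\<close> is the transform of the reflected
  \<open>fourier Q\<close> divided by \<open>2 * pi\<close>.\<close>

lemma wiener_bound_C2:
  assumes D1: "\<And>y. (Q has_vector_derivative Q' y) (at y)" and D2: "\<And>y. (Q' has_vector_derivative Q'' y) (at y)"
    and cont: "\<And>y. isCont Q'' y" and Q: "integrable lborel Q" and Q'': "integrable lborel Q''"
    and lim: "(Q \<longlongrightarrow> 0) at_infinity" "(Q' \<longlongrightarrow> 0) at_infinity"
    and bound: "\<And>y. norm (Q y) \<le> B"
  shows "wiener_bound Q (L1_norm Q + L1_norm Q'')"
proof -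
  let ?C = "L1_norm Q + L1_norm Q''"
  note le = norm_fourier_C2_le[OF D1 D2 cont Q Q'' lim]
  have C: "0 \<le> ?C" using L1_norm_nonneg by simp
  have int: "integrable lborel (\<lambda>x. ?C * (1 / (1 + x\<^sup>2)))"
    using integral_inverse_1_plus_square(1) by (rule integrable_mult_right)
  have q: "integrable lborel (fourier Q)"
    using le C by (intro Bochner_Integration.integrable_bound[OF int borel_measurable_fourier[OF Q]] AE_I2) simp
  have "L1_norm (fourier Q) \<le> (LINT x|lborel. ?C * (1 / (1 + x\<^sup>2)))"
    unfolding L1_norm_def[of "fourier Q"] using q int le by (intro integral_mono) auto
  also have "\<dots> = ?C * pi"
    by (simp only: integral_mult_right_zero integral_inverse_1_plus_square(2))
  finally have norm: "L1_norm (fourier Q) \<le> ?C * pi" .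
  have "wiener_bound (\<lambda>y. complex_of_real (2 * pi) * Q (- y)) (?C * pi)"
    using q fourier_inversion[OF Q has_vector_derivative_isCont[OF D1] bound q] norm by (intro wiener_boundI)
  from wiener_bound_cmult[OF wiener_bound_reflect[OF this], of "1 / complex_of_real (2 * pi)"]
  have "wiener_bound Q (norm (1 / complex_of_real (2 * pi)) * (?C * pi))" by simp
  moreover have "norm (1 / complex_of_real (2 * pi)) * (?C * pi) = ?C / 2"
    by (simp add: norm_divide norm_mult)
  ultimately have "wiener_bound Q (?C / 2)" by (simp only:)
  then show ?thesis using C by (elim wiener_bound_mono) simp
qed

text \<open>Telescoping. The bound retains the factor \<open>t\<close>, later the size of
  \<open>H y\<close>, so that integrability of \<open>H\<close> carries over to the powers; besides
  \<open>M ^ n\<close> only a factor \<open>n\<close> is lost.\<close>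

lemma norm_power_minus_1_le:
  fixes z :: "'a::real_normed_field"
  assumes z: "norm z \<le> M" and M: "1 \<le> M" and d: "norm (z - 1) \<le> M * t" and t: "0 \<le> t"
  shows "norm (z ^ n - 1) \<le> real n * M ^ n * t"
proof (induction n)
  case (Suc n)
  have "z ^ Suc n - 1 = z * (z ^ n - 1) + (z - 1)" by (simp add: algebra_simps)
  then have "norm (z ^ Suc n - 1) \<le> norm z * norm (z ^ n - 1) + norm (z - 1)"
    by (metis norm_mult norm_triangle_ineq)
  also have "\<dots> \<le> M * (real n * M ^ n * t) + M * t"
    using Suc z d M by (intro add_mono mult_mono) auto
  also have "M * t \<le> M ^ Suc n * t"
    using M t by (intro mult_right_mono) (auto simp: self_le_power)
  finally show ?case by (simp add: algebra_simps)
qed simp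

text \<open>
  The point is that the bound grows only like \<open>n\<^sup>2 m\<^sup>-\<^sup>n\<close>, where \<open>m\<close> is the minimum of the modulus.
\<close>

lemma wiener_bound_inverse_power:
  assumes D1: "\<And>y. (H has_vector_derivative H' y) (at y)" and D2: "\<And>y. (H' has_vector_derivative H'' y) (at y)"
    and cont: "\<And>y. isCont H'' y" and H: "integrable lborel H" and H'': "integrable lborel H''"
    and H'2: "integrable lborel (\<lambda>y. (H' y)\<^sup>2)"
    and lim: "(H \<longlongrightarrow> 0) at_infinity" "(H' \<longlongrightarrow> 0) at_infinity"
    and bound: "\<And>y. norm (H y) \<le> B"
    and m: "0 < m" "m \<le> 1" "\<And>y. m \<le> norm (1 + H y)"
  shows "wiener_bound (\<lambda>y. 1 / (1 + H y) ^ n - 1)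
    (real ((n + 1)\<^sup>2) * (1 / m) ^ (n + 2) * (L1_norm H + L1_norm (\<lambda>y. (H' y)\<^sup>2) + L1_norm H''))"
proof -
  \<comment> \<open>\<open>Q'\<close> and \<open>Q''\<close> are the first two derivatives of
    \<open>Z ^ n - 1\<close>. The factors \<open>n\<close> and \<open>n + 1\<close> brought down by
    differentiating account for the quadratic growth.\<close>
  define Z where "Z = (\<lambda>y. inverse (1 + H y))"
  define Q' where "Q' = (\<lambda>y. - of_nat n * Z y ^ (n + 1) * H' y)"
  define Q'' where "Q'' = (\<lambda>y. of_nat (n * (n + 1)) * Z y ^ (n + 2) * (H' y)\<^sup>2 - of_nat n * Z y ^ (n + 1) * H'' y)"
  \<comment> \<open>One constant majorising the coefficients of \<open>H\<close>, of the square of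
    \<open>H'\<close> and of \<open>H''\<close>; the powers can be raised to \<open>n + 2\<close>
    since \<open>1 / m\<close> is at least 1.\<close>
  define K where "K = real ((n + 1)\<^sup>2) * (1 / m) ^ (n + 2)"
  have M: "1 \<le> 1 / m" using m by simp
  have ne: "1 + H y \<noteq> 0" for y using m(1) m(3)[of y] by auto
  have Z_le: "norm (Z y) \<le> 1 / m" for y
    unfolding Z_def norm_inverse using m(1) m(3)[of y] by (simp add: inverse_eq_divide frac_le)
  have DZ: "(Z has_vector_derivative - (Z y)\<^sup>2 * H' y) (at y)" for y
  proof -
    have "((inverse \<circ> (\<lambda>y. 1 + H y)) has_vector_derivative (0 + H' y) * - (inverse (1 + H y) ^ Suc (Suc 0))) (at y)"
      by (intro field_vector_diff_chain_at has_vector_derivative_add has_vector_derivative_const D1 DERIV_inverse ne)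
    then show ?thesis by (simp add: Z_def comp_def power2_eq_square mult_ac)
  qed
  have DZp: "((\<lambda>y. Z y ^ k) has_vector_derivative - of_nat k * Z y ^ (k + 1) * H' y) (at y)" for k y
  proof -
    have "(((\<lambda>z. z ^ k) \<circ> Z) has_vector_derivative (- (Z y)\<^sup>2 * H' y) * (of_nat k * Z y ^ (k - Suc 0))) (at y)"
      by (intro field_vector_diff_chain_at DZ) (auto intro!: derivative_eq_intros)
    \<comment> \<open>For \<open>k = 0\<close> the truncated exponent \<open>k - Suc 0\<close> is 0,
      and both sides vanish because of the factor \<open>k\<close>.\<close>
    moreover have "(- (Z y)\<^sup>2 * H' y) * (of_nat k * Z y ^ (k - Suc 0)) = - of_nat k * Z y ^ (k + 1) * H' y"
      by (cases k) (auto simp: power2_eq_square algebra_simps)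
    ultimately show ?thesis by (simp only: comp_def)
  qed
  let ?Q = "\<lambda>y. Z y ^ n - 1"
  have DQ: "(?Q has_vector_derivative Q' y) (at y)" for y
    using has_vector_derivative_diff[OF DZp[of n y] has_vector_derivative_const[of 1]] by (simp add: Q'_def)
  have DQ': "(Q' has_vector_derivative Q'' y) (at y)" for y
  proof -
    have "((\<lambda>y. - of_nat n * (Z y ^ (n + 1) * H' y)) has_vector_derivative
        - of_nat n * (Z y ^ (n + 1) * H'' y + (- of_nat (n + 1) * Z y ^ (n + 1 + 1) * H' y) * H' y)) (at y)"
      by (intro has_vector_derivative_mult_right has_vector_derivative_mult DZp D2)
    then show ?thesis
      by (simp add: Q'_def Q''_def algebra_simps power2_eq_square)
  qed
  have isCont: "isCont Z y" "isCont H' y" for y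
    using DZ D2 by (auto intro: has_vector_derivative_isCont)
  have cQ'': "isCont Q'' y" for y
    unfolding Q''_def by (intro continuous_intros isCont cont)
  have cQ: "isCont ?Q y" for y
    by (intro continuous_intros isCont)
  have meas: "?Q \<in> borel_measurable lborel" "Q'' \<in> borel_measurable lborel"
    using cQ cQ'' by (auto intro!: borel_measurable_continuous_onI continuous_at_imp_continuous_on)
  have K: "real n * (1 / m) ^ n \<le> K" "real n * (1 / m) ^ (n + 1) \<le> K" "real (n * (n + 1)) * (1 / m) ^ (n + 2) \<le> K"
  proof -
    have n: "real n \<le> real ((n + 1)\<^sup>2)" "real (n * (n + 1)) \<le> real ((n + 1)\<^sup>2)"
      unfolding of_nat_le_iff by (auto simp: power2_eq_square)
    have "(1 / m) ^ n \<le> (1 / m) ^ (n + 2)" "(1 / m) ^ (n + 1) \<le> (1 / m) ^ (n + 2)"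
      using M by (intro power_increasing; simp)+
    then show "real n * (1 / m) ^ n \<le> K" "real n * (1 / m) ^ (n + 1) \<le> K" "real (n * (n + 1)) * (1 / m) ^ (n + 2) \<le> K"
      unfolding K_def using n M m(1) by (intro mult_mono; simp)+
  qed
  have "0 \<le> K" using m(1) by (simp add: K_def)
  have Q_le: "norm (?Q y) \<le> K * norm (H y)" for y
  proof -
    \<comment> \<open>The factor \<open>H\<close> in \<open>Z - 1\<close> supplies the integrability
      of \<open>Z ^ n - 1\<close>.\<close>
    have "Z y - 1 = - (Z y * H y)" using ne[of y] by (simp add: Z_def field_simps)
    then have "norm (Z y - 1) \<le> 1 / m * norm (H y)"
      using mult_right_mono[OF Z_le[of y], of "norm (H y)"] by (simp add: norm_mult)
    from norm_power_minus_1_le[OF Z_le M this] have "norm (?Q y) \<le> real n * (1 / m) ^ n * norm (H y)" by simp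
    also have "\<dots> \<le> K * norm (H y)" using K(1) by (rule mult_right_mono) simp
    finally show ?thesis .
  qed
  have Q''_le: "norm (Q'' y) \<le> K * norm ((H' y)\<^sup>2) + K * norm (H'' y)" for y
  proof -
    have "norm (Q'' y) \<le> real (n * (n + 1)) * norm (Z y) ^ (n + 2) * norm ((H' y)\<^sup>2) + real n * norm (Z y) ^ (n + 1) * norm (H'' y)"
      unfolding Q''_def by (rule order_trans[OF norm_triangle_ineq4]) (simp only: norm_mult norm_power norm_of_nat order_refl)
    also have "\<dots> \<le> real (n * (n + 1)) * (1 / m) ^ (n + 2) * norm ((H' y)\<^sup>2) + real n * (1 / m) ^ (n + 1) * norm (H'' y)"
      using Z_le[of y] by (intro add_mono mult_right_mono mult_left_mono power_mono) auto
    also have "\<dots> \<le> K * norm ((H' y)\<^sup>2) + K * norm (H'' y)"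
      using K by (intro add_mono mult_right_mono) auto
    finally show ?thesis .
  qed
  have intQ: "integrable lborel ?Q"
  proof (rule Bochner_Integration.integrable_bound)
    show "integrable lborel (\<lambda>y. K * norm (H y))" using H by (intro integrable_mult_right integrable_norm)
    show "AE y in lborel. norm (?Q y) \<le> norm (K * norm (H y))"
      using order_trans[OF Q_le abs_ge_self] by (intro AE_I2) (simp only: real_norm_def)
  qed (rule meas)
  have intb: "integrable lborel (\<lambda>y. K * norm ((H' y)\<^sup>2) + K * norm (H'' y))"
    using H'2 H'' by (intro Bochner_Integration.integrable_add integrable_mult_right integrable_norm)
  have intQ'': "integrable lborel Q''"
  proof (rule Bochner_Integration.integrable_bound[OF intb])
    show "AE y in lborel. norm (Q'' y) \<le> norm (K * norm ((H' y)\<^sup>2) + K * norm (H'' y))"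
      using order_trans[OF Q''_le abs_ge_self] by (intro AE_I2) (simp only: real_norm_def)
  qed (rule meas)
  have limZ: "(Z \<longlongrightarrow> inverse (1 + 0)) at_infinity"
    unfolding Z_def by (intro tendsto_intros lim) simp
  have "(?Q \<longlongrightarrow> inverse (1 + 0) ^ n - 1) at_infinity"
    by (intro tendsto_intros limZ)
  then have limQ: "(?Q \<longlongrightarrow> 0) at_infinity" by simp
  have "(Q' \<longlongrightarrow> - of_nat n * inverse (1 + 0) ^ (n + 1) * 0) at_infinity"
    unfolding Q'_def by (intro tendsto_intros limZ lim)
  then have limQ': "(Q' \<longlongrightarrow> 0) at_infinity" by simp
  have "norm (?Q y) \<le> K * B" for y
    using Q_le[of y] mult_left_mono[OF bound[of y] \<open>0 \<le> K\<close>] by linarith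
  from wiener_bound_C2[OF DQ DQ' cQ'' intQ intQ'' limQ limQ' this]
  have "wiener_bound ?Q (L1_norm ?Q + L1_norm Q'')" .
  moreover have "L1_norm ?Q + L1_norm Q'' \<le> K * (L1_norm H + L1_norm (\<lambda>y. (H' y)\<^sup>2) + L1_norm H'')"
  proof -
    have "L1_norm ?Q \<le> (LINT y|lborel. K * norm (H y))"
      unfolding L1_norm_def using intQ H Q_le by (intro integral_mono) auto
    moreover have "L1_norm Q'' \<le> (LINT y|lborel. K * norm ((H' y)\<^sup>2) + K * norm (H'' y))"
      unfolding L1_norm_def using intQ'' intb Q''_le by (intro integral_mono) auto
    moreover have "(LINT y|lborel. K * norm ((H' y)\<^sup>2) + K * norm (H'' y))
        = (LINT y|lborel. K * norm ((H' y)\<^sup>2)) + (LINT y|lborel. K * norm (H'' y))"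
      using H'2 H'' by (intro Bochner_Integration.integral_add integrable_mult_right integrable_norm)
    ultimately show ?thesis
      by (simp add: L1_norm_def distrib_left)
  qed
  ultimately have "wiener_bound ?Q (K * (L1_norm H + L1_norm (\<lambda>y. (H' y)\<^sup>2) + L1_norm H''))"
    by (rule wiener_bound_mono)
  moreover have "?Q = (\<lambda>y. 1 / (1 + H y) ^ n - 1)"
    by (simp add: Z_def power_inverse inverse_eq_divide power_one_over)
  ultimately show ?thesis by (simp only: K_def)
qed

section \<open>Differentiability of the transform\<close>

lemma norm_cis_second_order: "norm (cis x - 1 - \<i> * complex_of_real x) \<le> x\<^sup>2 / 2"
  using iexp_approx1[of x 1] by (simp add: cis_conv_exp power2_eq_square algebra_simps)

text \<open>Taylor's formula for \<open>cis\<close>, integrated against \<open>f\<close>, leaves an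
  error of at most \<open>h\<^sup>2\<close> times the second absolute moment of \<open>f\<close>;
  divided by \<open>h\<close> it tends to 0.\<close>

lemma fourier_has_vector_derivative:
  assumes f: "\<And>k. integrable lborel (\<lambda>x. complex_of_real (x ^ k) * f x)"
  shows "(fourier f has_vector_derivative fourier (\<lambda>x. \<i> * complex_of_real x * f x) y) (at y)"
proof -
  let ?D = "fourier (\<lambda>x. \<i> * complex_of_real x * f x) y"
  let ?C = "L1_norm (\<lambda>x. complex_of_real (x\<^sup>2) * f x)"
  have f0: "integrable lborel f" using f[of 0] by simp
  have f1: "integrable lborel (\<lambda>x. \<i> * complex_of_real x * f x)"
    using integrable_mult_right[OF f[of 1], of \<i>] by (simp add: mult.assoc)
  have bound: "norm (fourier f (y + h) - fourier f y - h *\<^sub>R ?D) \<le> h\<^sup>2 * ?C" for h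
  proof -
    have "fourier f (y + h) - fourier f y - h *\<^sub>R ?D
        = fourier (\<lambda>x. f x * (cis (x * h) - 1 - \<i> * complex_of_real (x * h))) y"
    proof -
      have "fourier f (y + h) = fourier (\<lambda>x. f x * cis (x * h)) y"
        unfolding fourier_def by (simp add: distrib_left mult.assoc cis_mult add.commute)
      moreover have "h *\<^sub>R ?D = fourier (\<lambda>x. complex_of_real h * (\<i> * complex_of_real x * f x)) y"
        by (simp add: fourier_cmult scaleR_conv_of_real)
      moreover have "(\<lambda>x. f x * (cis (x * h) - 1 - \<i> * complex_of_real (x * h)))
          = (\<lambda>x. f x * cis (x * h) - f x - complex_of_real h * (\<i> * complex_of_real x * f x))"
        by (auto simp: algebra_simps)
      ultimately show ?thesis
        using f0 f1 integrable_mult_cis[OF f0, of h]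
        by (simp only: fourier_diff Bochner_Integration.integrable_diff integrable_mult_right)
    qed
    also have "norm \<dots> \<le> L1_norm (\<lambda>x. f x * (cis (x * h) - 1 - \<i> * complex_of_real (x * h)))"
      by (rule norm_fourier_le)
    also have "\<dots> \<le> (LINT x|lborel. h\<^sup>2 * norm (complex_of_real (x\<^sup>2) * f x))"
      unfolding L1_norm_def
    proof (rule integral_mono)
      show "norm (f x * (cis (x * h) - 1 - \<i> * complex_of_real (x * h))) \<le> h\<^sup>2 * norm (complex_of_real (x\<^sup>2) * f x)" for x
      proof -
        have "norm (cis (x * h) - 1 - \<i> * complex_of_real (x * h)) \<le> (x * h)\<^sup>2"
          using norm_cis_second_order[of "x * h"] zero_le_power2[of "x * h"] by linarith
        from mult_left_mono[OF this norm_ge_zero[of "f x"]] show ?thesis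
          by (simp add: norm_mult norm_power power_mult_distrib mult_ac)
      qed
      have "integrable lborel (\<lambda>x. f x * cis (x * h) - f x - complex_of_real h * (\<i> * complex_of_real x * f x))"
        using f0 f1 integrable_mult_cis[OF f0, of h]
        by (intro Bochner_Integration.integrable_diff integrable_mult_right)
      then show "integrable lborel (\<lambda>x. norm (f x * (cis (x * h) - 1 - \<i> * complex_of_real (x * h))))"
        by (intro integrable_norm) (simp add: algebra_simps)
      show "integrable lborel (\<lambda>x. h\<^sup>2 * norm (complex_of_real (x\<^sup>2) * f x))"
        using f[of 2] by (intro integrable_mult_right integrable_norm)
    qed
    finally show ?thesis by (simp add: L1_norm_def)
  qed
  have "(\<lambda>h. norm (fourier f (y + h) - fourier f y - h *\<^sub>R ?D) / norm h) \<midarrow>0\<rightarrow> 0"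
  proof (rule Lim_null_comparison)
    have "(\<lambda>h::real. \<bar>h\<bar> * ?C) \<midarrow>0\<rightarrow> \<bar>0\<bar> * ?C" by (intro tendsto_intros)
    then show "(\<lambda>h::real. \<bar>h\<bar> * ?C) \<midarrow>0\<rightarrow> 0" by simp
    have "norm (norm (fourier f (y + h) - fourier f y - h *\<^sub>R ?D) / norm h) \<le> \<bar>h\<bar> * ?C" if "h \<noteq> 0" for h
    proof -
      have "h\<^sup>2 * ?C = \<bar>h\<bar> * ?C * \<bar>h\<bar>"
        by (simp add: power2_eq_square mult_ac)
      with bound[of h] have "norm (fourier f (y + h) - fourier f y - h *\<^sub>R ?D) \<le> \<bar>h\<bar> * ?C * \<bar>h\<bar>"
        by (simp only:)
      with that show ?thesis by (simp add: pos_divide_le_eq)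
    qed
    then show "eventually (\<lambda>h. norm (norm (fourier f (y + h) - fourier f y - h *\<^sub>R ?D) / norm h) \<le> \<bar>h\<bar> * ?C) (at 0)"
      by (auto simp: eventually_at_filter)
  qed
  then show ?thesis
    unfolding has_vector_derivative_def has_derivative_at by (simp add: bounded_linear_scaleR_left)
qed

section \<open>Wiener's lemma\<close>

lemma integrable_moment_exp_gauss:
  assumes s: "s > 0"
  shows "integrable lborel (\<lambda>y. complex_of_real (y ^ k * exp (- (y / s)\<^sup>2 / 2)))"
proof -
  have "integrable lborel (\<lambda>y. sqrt (2 * pi) * s ^ k * (std_normal_density (0 + 1 / s * y) * (0 + 1 / s * y) ^ k))"
    using s by (intro integrable_mult_right lborel_integrable_real_affine[OF integrable_std_normal_moment]) simp
  moreover have "sqrt (2 * pi) * s ^ k * (std_normal_density (0 + 1 / s * y) * (0 + 1 / s * y) ^ k) = y ^ k * exp (- (y / s)\<^sup>2 / 2)" for y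
    using s by (simp add: std_normal_density_def power_divide)
  ultimately show ?thesis by (simp only: integrable_of_real)
qed

lemma tendsto_exp_gauss:
  assumes s: "s > 0"
  shows "((\<lambda>y. exp (- (y / s)\<^sup>2 / 2)) \<longlongrightarrow> (0::real)) at_infinity"
    and "((\<lambda>y. y * exp (- (y / s)\<^sup>2 / 2)) \<longlongrightarrow> (0::real)) at_infinity"
  unfolding at_infinity_eq_at_top_bot using s
  by (intro filterlim_sup; real_asymp)+

lemma tendsto_mult_bounded_0:
  fixes h w :: "'a \<Rightarrow> 'b::real_normed_algebra"
  assumes "\<And>y. norm (h y) \<le> B" "(w \<longlongrightarrow> 0) F"
  shows "((\<lambda>y. h y * w y) \<longlongrightarrow> 0) F"
proof (rule Lim_null_comparison)
  have "((\<lambda>y. B * norm (w y)) \<longlongrightarrow> B * norm (0::'b)) F"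
    by (intro tendsto_intros assms)
  then show "((\<lambda>y. B * norm (w y)) \<longlongrightarrow> 0) F" by simp
  show "eventually (\<lambda>y. norm (h y * w y) \<le> B * norm (w y)) F"
    by (intro always_eventually allI order_trans[OF norm_mult_ineq] mult_right_mono assms) simp
qed

lemma integrable_moment_truncate:
  assumes f: "integrable lborel f" and r: "r \<ge> 0"
  shows "integrable lborel (\<lambda>x. complex_of_real (x ^ k) * (f x * indicator {-r..r} x))"
proof -
  have "integrable lborel (\<lambda>x. f x * (complex_of_real (x ^ k) * indicator {-r..r} x))"
  proof (rule integrable_mult_bounded[OF f])
    show "norm (complex_of_real (x ^ k) * indicator {-r..r} x) \<le> r ^ k" for x
      using r by (auto simp: indicator_def norm_power intro!: power_mono)
  qed measurable
  then show ?thesis by (simp add: mult_ac)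
qed

lemma truncate_tendsto_L1:
  assumes f: "integrable lborel f"
  shows "(\<lambda>n. L1_norm (\<lambda>x. f x * indicator {- real n..real n} x - f x)) \<longlonglongrightarrow> 0"
proof -
  have "(\<lambda>n. LINT x|lborel. norm (f x * indicator {- real n..real n} x - f x)) \<longlonglongrightarrow> (LINT x|(lborel::real measure). (0::real))"
  proof (rule integral_dominated_convergence[where w = "\<lambda>x. norm (f x)"])
    have "(\<lambda>n. norm (f x * indicator {- real n..real n} x - f x)) \<longlonglongrightarrow> 0" for x
    proof (rule tendsto_eventually)
      have "norm (f x * indicator {- real n..real n} x - f x) = 0" if "n \<ge> nat \<lceil>\<bar>x\<bar>\<rceil>" for n
      proof -
        have "\<bar>x\<bar> \<le> real n" using that by (simp add: nat_ceiling_le_eq)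
        then show ?thesis by (auto simp: indicator_def)
      qed
      then show "eventually (\<lambda>n. norm (f x * indicator {- real n..real n} x - f x) = 0) sequentially"
        unfolding eventually_sequentially by blast
    qed
    then show "AE x in lborel. (\<lambda>n. norm (f x * indicator {- real n..real n} x - f x)) \<longlonglongrightarrow> 0" by simp
    show "AE x in lborel. norm (norm (f x * indicator {- real n..real n} x - f x)) \<le> norm (f x)" for n
      by (intro AE_I2) (auto simp: indicator_def)
  qed (use f in auto)
  then show ?thesis by (simp add: L1_norm_def)
qed

text \<open>Truncation of \<open>f\<close> to a bounded interval makes all moments finite and thus
  the transform differentiable; convolution with a narrow Gaussian multiplies the transform by a
  wide one and so gives the decay. Each change costs less than \<open>e/2\<close>.\<close>

lemma smooth_transform_approx:
  assumes f: "integrable lborel f" and e: "e > 0"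
  obtains k H' H'' where "integrable lborel k" "L1_norm (\<lambda>x. f x - k x) < e"
    "\<And>y. (fourier k has_vector_derivative H' y) (at y)" "\<And>y. (H' has_vector_derivative H'' y) (at y)"
    "\<And>y. isCont H'' y" "integrable lborel (fourier k)" "integrable lborel H''"
    "integrable lborel (\<lambda>y. (H' y)\<^sup>2)" "(fourier k \<longlongrightarrow> 0) at_infinity" "(H' \<longlongrightarrow> 0) at_infinity"
proof -
  from e have e2: "e/2 > 0" by simp
  obtain n where n: "L1_norm (\<lambda>x. f x * indicator {- real n..real n} x - f x) < e/2"
    using eventually_happens[OF order_tendstoD(2)[OF truncate_tendsto_L1[OF f] e2]] by auto
  define f0 where "f0 = (\<lambda>x. f x * indicator {- real n..real n} x)"
  \<comment> \<open>Multiplication by \<open>\<i> * x\<close> corresponds to differentiating the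
    transform: \<open>f1\<close> and \<open>f2\<close> have the first two derivatives of
    \<open>fourier f0\<close> as transforms.\<close>
  define f1 where "f1 = (\<lambda>x. \<i> * complex_of_real x * f0 x)"
  define f2 where "f2 = (\<lambda>x. \<i> * complex_of_real x * f1 x)"
  have mom0: "integrable lborel (\<lambda>x. complex_of_real (x ^ k) * f0 x)" for k
    unfolding f0_def using integrable_moment_truncate[OF f] by simp
  have mom1: "integrable lborel (\<lambda>x. complex_of_real (x ^ k) * f1 x)" for k
    using integrable_mult_right[OF mom0[of "Suc k"], of \<i>] by (simp add: f1_def mult_ac)
  have mom2: "integrable lborel (\<lambda>x. complex_of_real (x ^ k) * f2 x)" for k
    using integrable_mult_right[OF mom1[of "Suc k"], of \<i>] by (simp add: f2_def mult_ac)
  have int: "integrable lborel f0" "integrable lborel f1" "integrable lborel f2"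
    using mom0[of 0] mom1[of 0] mom2[of 0] by simp_all
  obtain N where N: "L1_norm (\<lambda>x. convol f0 (gauss_mollifier (real (Suc N))) x - f0 x) < e/2"
    using eventually_happens[OF order_tendstoD(2)[OF convol_gauss_mollifier_tendsto[OF int(1)] e2]] by auto
  define s where "s = real (Suc N)"
  have s: "s > 0" by (simp add: s_def)
  define k where "k = convol f0 (gauss_mollifier s)"
  \<comment> \<open>The Gaussian factor is \<open>w 0\<close>; its derivative is
    \<open>- c * w 1\<close>, and that of \<open>w 1\<close> is \<open>w 0 - c * w 2\<close>. So
    \<open>H'\<close> and \<open>H''\<close> are what the product rule gives for
    \<open>fourier k\<close>.\<close>
  define c where "c = complex_of_real (1 / s\<^sup>2)"
  define w where "w = (\<lambda>j y. complex_of_real (y ^ j * exp (- (y / s)\<^sup>2 / 2)))"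
  let ?p0 = "fourier f0" and ?p1 = "fourier f1" and ?p2 = "fourier f2"
  define H' where "H' = (\<lambda>y. ?p1 y * w 0 y - c * (?p0 y * w 1 y))"
  define H'' where "H'' = (\<lambda>y. ?p2 y * w 0 y - c * (?p1 y * w 1 y) - c * (?p1 y * w 1 y + ?p0 y * (w 0 y - c * w 2 y)))"
  have k: "integrable lborel k"
    unfolding k_def by (intro integrable_convol int integrable_gauss_mollifier s)
  have Fk: "fourier k = (\<lambda>y. ?p0 y * w 0 y)"
    unfolding k_def w_def by (simp add: fun_eq_iff fourier_convol int integrable_gauss_mollifier s fourier_gauss_mollifier)
  have "L1_norm (\<lambda>x. f x - k x) < e"
  proof -
    have "L1_norm (\<lambda>x. f x - k x) \<le> (LINT x|lborel. norm (f0 x - f x) + norm (k x - f0 x))"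
      unfolding L1_norm_def
    proof (rule integral_mono)
      show "norm (f x - k x) \<le> norm (f0 x - f x) + norm (k x - f0 x)" for x
        using norm_triangle_ineq4[of "- (f0 x - f x)" "k x - f0 x"]
        by (simp only: norm_minus_cancel) (simp add: norm_minus_commute)
    qed (use f k int in auto)
    also have "\<dots> = L1_norm (\<lambda>x. f0 x - f x) + L1_norm (\<lambda>x. k x - f0 x)"
      unfolding L1_norm_def using f k int by (intro Bochner_Integration.integral_add) auto
    finally show ?thesis using n N by (simp add: f0_def k_def s_def)
  qed
  moreover have Dp: "(?p0 has_vector_derivative ?p1 y) (at y)" "(?p1 has_vector_derivative ?p2 y) (at y)" for y
    using fourier_has_vector_derivative[OF mom0] fourier_has_vector_derivative[OF mom1]
    by (simp_all only: f1_def f2_def)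
  have Dw: "(w 0 has_vector_derivative - c * w 1 y) (at y)" "(w 1 has_vector_derivative w 0 y - c * w 2 y) (at y)" for y
  proof -
    have "(w 0 has_vector_derivative complex_of_real (- (1 / s\<^sup>2) * (y ^ 1 * exp (- (y / s)\<^sup>2 / 2)))) (at y)"
      unfolding w_def using s
      by (intro has_vector_derivative_of_real) (auto intro!: derivative_eq_intros simp: field_simps power2_eq_square)
    then show "(w 0 has_vector_derivative - c * w 1 y) (at y)"
      by (simp add: w_def c_def)
    have "(w 1 has_vector_derivative complex_of_real (exp (- (y / s)\<^sup>2 / 2) - (1 / s\<^sup>2) * (y ^ 2 * exp (- (y / s)\<^sup>2 / 2)))) (at y)"
      unfolding w_def using s
      by (intro has_vector_derivative_of_real) (auto intro!: derivative_eq_intros simp: field_simps power2_eq_square)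
    then show "(w 1 has_vector_derivative w 0 y - c * w 2 y) (at y)"
      by (simp add: w_def c_def)
  qed
  have DH: "(fourier k has_vector_derivative H' y) (at y)" for y
    using has_vector_derivative_mult[OF Dp(1) Dw(1), of y] unfolding Fk H'_def
    by (simp add: algebra_simps)
  have DH': "(H' has_vector_derivative H'' y) (at y)" for y
  proof -
    have "(H' has_vector_derivative (?p1 y * (- c * w 1 y) + ?p2 y * w 0 y)
        - c * (?p0 y * (w 0 y - c * w 2 y) + ?p1 y * w 1 y)) (at y)"
      unfolding H'_def
      by (intro has_vector_derivative_diff has_vector_derivative_mult_right has_vector_derivative_mult Dp Dw)
    then show ?thesis by (simp add: H''_def algebra_simps)
  qed
  have cont: "isCont (w j) y" "isCont ?p0 y" "isCont ?p1 y" "isCont ?p2 y" for j y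
    unfolding w_def using s by (auto intro!: continuous_intros isCont_fourier int)
  have contH'': "isCont H'' y" for y
    unfolding H''_def by (intro continuous_intros cont)
  have meas: "h \<in> borel_measurable lborel" if "\<And>y. isCont h y" for h :: "real \<Rightarrow> complex"
    using that by (auto intro!: borel_measurable_continuous_onI continuous_at_imp_continuous_on)
  have w0: "norm (w 0 y) \<le> 1" for y by (simp add: w_def)
  have intw: "integrable lborel (\<lambda>y. h y * w j y)" if "\<And>y. isCont h y" "\<And>y. norm (h y) \<le> B" for h B j
    using integrable_mult_bounded[OF integrable_moment_exp_gauss[OF s] meas[OF that(1)] that(2), of j]
    by (simp add: w_def mult.commute)
  have int_p: "integrable lborel (\<lambda>y. ?p0 y * w j y)" "integrable lborel (\<lambda>y. ?p1 y * w j y)" "integrable lborel (\<lambda>y. ?p2 y * w j y)" for j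
    by (rule intw, rule cont, rule norm_fourier_le)+
  have "integrable lborel (fourier k)"
    unfolding Fk by (rule int_p)
  moreover have "integrable lborel H''"
  proof -
    have "integrable lborel (\<lambda>y. ?p2 y * w 0 y - c * (?p1 y * w 1 y) - c * (?p1 y * w 1 y + (?p0 y * w 0 y - c * (?p0 y * w 2 y))))"
      by (intro Bochner_Integration.integrable_diff Bochner_Integration.integrable_add integrable_mult_right int_p)
    then show ?thesis by (simp add: H''_def algebra_simps)
  qed
  moreover have "integrable lborel (\<lambda>y. (H' y)\<^sup>2)"
  proof -
    \<comment> \<open>The square of \<open>H'\<close> is a combination of products of two transforms
      and two Gaussian factors; one factor \<open>w 0\<close> joins the bounded part, and
      \<open>w j\<close> supplies the integrability.\<close>
    have intpp: "integrable lborel (\<lambda>y. (fourier g y * fourier h y * w 0 y) * w j y)"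
      if "integrable lborel g" "integrable lborel h" for g h j
    proof (rule intw)
      show "norm (fourier g y * fourier h y * w 0 y) \<le> L1_norm g * L1_norm h * 1" for y
        unfolding norm_mult using L1_norm_nonneg
        by (intro mult_mono norm_fourier_le w0 mult_nonneg_nonneg) auto
    qed (intro continuous_intros cont isCont_fourier that)
    have "integrable lborel (\<lambda>y. (?p1 y * ?p1 y * w 0 y) * w 0 y - 2 * c * ((?p1 y * ?p0 y * w 0 y) * w 1 y)
        + c\<^sup>2 * ((?p0 y * ?p0 y * w 0 y) * w 2 y))"
      by (intro Bochner_Integration.integrable_diff Bochner_Integration.integrable_add integrable_mult_right intpp int)
    moreover have "(?p1 y * ?p1 y * w 0 y) * w 0 y - 2 * c * ((?p1 y * ?p0 y * w 0 y) * w 1 y)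
        + c\<^sup>2 * ((?p0 y * ?p0 y * w 0 y) * w 2 y) = (H' y)\<^sup>2" for y
    proof -
      \<comment> \<open>Brings the term with the square of \<open>w 1\<close> into the form treated
        by \<open>intpp\<close>.\<close>
      have "w 0 y * w 2 y = w 1 y * w 1 y"
        by (simp add: w_def power2_eq_square)
      then have "c\<^sup>2 * ((?p0 y * ?p0 y * w 0 y) * w 2 y) = c\<^sup>2 * (?p0 y * ?p0 y * (w 1 y * w 1 y))"
        by (simp only: mult.assoc)
      then show ?thesis by (simp only: H'_def) (simp add: algebra_simps power2_eq_square)
    qed
    ultimately show ?thesis by (simp only:)
  qed
  moreover have limw: "(w 0 \<longlongrightarrow> 0) at_infinity" "(w 1 \<longlongrightarrow> 0) at_infinity"
    using tendsto_exp_gauss[OF s, THEN tendsto_of_real[where 'a = complex]] unfolding w_def by simp_all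
  have "(fourier k \<longlongrightarrow> 0) at_infinity"
    unfolding Fk by (rule tendsto_mult_bounded_0[OF norm_fourier_le limw(1)])
  moreover have "(H' \<longlongrightarrow> 0 - c * 0) at_infinity"
    unfolding H'_def
    by (intro tendsto_diff tendsto_mult_left tendsto_mult_bounded_0[OF norm_fourier_le] limw)
  ultimately show ?thesis
    using k DH DH' contH'' by (intro that[of k H' H'']) simp_all
qed

text \<open>The transforms of the smooth approximants vanish at infinity, and approximation in L1 is
  uniform approximation of the transforms.\<close>

lemma riemann_lebesgue:
  assumes f: "integrable lborel f"
  shows "(fourier f \<longlongrightarrow> 0) at_infinity"
proof (rule tendstoI)
  fix e :: real assume "e > 0"
  then have "e/2 > 0" by simp
  from smooth_transform_approx[OF f this] obtain k where k: "integrable lborel k"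
    "L1_norm (\<lambda>x. f x - k x) < e/2" "(fourier k \<longlongrightarrow> 0) at_infinity" by metis
  from tendstoD[OF k(3) \<open>e/2 > 0\<close>] show "eventually (\<lambda>y. dist (fourier f y) 0 < e) at_infinity"
  proof eventually_elim
    fix y assume y: "dist (fourier k y) 0 < e/2"
    have "fourier f y = fourier (\<lambda>x. f x - k x) y + fourier k y"
      using f k(1) by (simp add: fourier_diff)
    then have "norm (fourier f y) \<le> L1_norm (\<lambda>x. f x - k x) + norm (fourier k y)"
      using norm_triangle_ineq norm_fourier_le add_right_mono order_trans by metis
    with y k(2) show "dist (fourier f y) 0 < e" by simp
  qed
qed

text \<open>Outside a compact interval the transform is below 1/2 in modulus, by Riemann-Lebesgue;
  on the interval the modulus of \<open>1 + fourier f\<close> attains a positive minimum.\<close>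

lemma one_plus_fourier_bounded_below:
  assumes f: "integrable lborel f" and ne: "\<And>y. 1 + fourier f y \<noteq> 0"
  obtains d where "0 < d" "d \<le> 1" "\<And>y. d \<le> norm (1 + fourier f y)"
proof -
  have "eventually (\<lambda>y. dist (fourier f y) 0 < 1/2) at_infinity"
    using riemann_lebesgue[OF f] by (rule tendstoD) simp
  then obtain R where R: "\<And>y. R \<le> norm y \<Longrightarrow> norm (fourier f y) < 1/2"
    by (auto simp: eventually_at_infinity)
  \<comment> \<open>The absolute value keeps the interval nonempty for negative \<open>R\<close>, so
    that the minimum is attained.\<close>
  have "continuous_on {-\<bar>R\<bar>..\<bar>R\<bar>} (\<lambda>y. norm (1 + fourier f y))"
    by (intro continuous_at_imp_continuous_on ballI continuous_intros isCont_fourier f)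
  then obtain x where x: "\<And>y. y \<in> {-\<bar>R\<bar>..\<bar>R\<bar>} \<Longrightarrow> norm (1 + fourier f x) \<le> norm (1 + fourier f y)"
    using continuous_attains_inf[of "{-\<bar>R\<bar>..\<bar>R\<bar>}" "\<lambda>y. norm (1 + fourier f y)"] by fastforce
  show ?thesis
  proof (rule that)
    show "0 < min (norm (1 + fourier f x)) (1/2)" using ne by simp
    show "min (norm (1 + fourier f x)) (1/2) \<le> norm (1 + fourier f y)" for y
    proof (cases "y \<in> {-\<bar>R\<bar>..\<bar>R\<bar>}")
      case True
      then show ?thesis using x by (simp add: min.coboundedI1)
    next
      case False
      then have "norm (fourier f y) < 1/2" by (intro R) auto
      moreover have "1 \<le> norm (1 + fourier f y) + norm (fourier f y)"
        using norm_triangle_ineq4[of "1 + fourier f y" "fourier f y"] by simp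
      ultimately show ?thesis by simp
    qed
  qed simp
qed

section \<open>Geometric series and Wiener's lemma\<close>

lemma inverse_diff_sums:
  fixes p r :: complex
  assumes "norm r < norm p"
  shows "(\<lambda>n. r ^ n * (1 / p) ^ Suc n) sums (1 / (p - r))"
proof -
  have p: "p \<noteq> 0" using assms by auto
  have "(\<lambda>n. (r / p) ^ n) sums (1 / (1 - r / p))"
    using assms p by (intro geometric_sums) (simp add: norm_divide)
  from sums_mult[OF this, of "1 / p"] show ?thesis
    using p by (simp add: field_simps power_divide)
qed

text \<open>The 1 is subtracted because \<open>1 / (1 + fourier f y)\<close> tends to 1 at infinity,
  whereas a transform vanishes there.\<close>

lemma wiener_lemma:
  assumes f: "integrable lborel f" and ne: "\<And>y. 1 + fourier f y \<noteq> 0"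
  obtains l where "integrable lborel l" "\<And>y. fourier l y = 1 / (1 + fourier f y) - 1"
proof -
  obtain d where d: "0 < d" "d \<le> 1" "\<And>y. d \<le> norm (1 + fourier f y)"
    using one_plus_fourier_bounded_below[OF f ne] by blast
  then have d4: "d / 4 > 0" by simp
  obtain k H' H'' where k: "integrable lborel k" "L1_norm (\<lambda>x. f x - k x) < d / 4"
    and D: "\<And>y. (fourier k has_vector_derivative H' y) (at y)" "\<And>y. (H' has_vector_derivative H'' y) (at y)"
    and H: "\<And>y. isCont H'' y" "integrable lborel (fourier k)" "integrable lborel H''"
      "integrable lborel (\<lambda>y. (H' y)\<^sup>2)" "(fourier k \<longlongrightarrow> 0) at_infinity" "(H' \<longlongrightarrow> 0) at_infinity"
    by (rule smooth_transform_approx[OF f d4], rule that)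
  \<comment> \<open>This is \<open>d - d / 4\<close>: the lower bound for
    \<open>1 + fourier f\<close>, diminished by the bound for \<open>r\<close>.\<close>
  define m where "m = 3 * d / 4"
  define P where "P = (\<lambda>y. 1 + fourier k y)"
  define r where "r = (\<lambda>y. fourier k y - fourier f y)"
  define C where "C = L1_norm (fourier k) + L1_norm (\<lambda>y. (H' y)\<^sup>2) + L1_norm H''"
  have C: "0 \<le> C" unfolding C_def using L1_norm_nonneg by (intro add_nonneg_nonneg)
  have r: "wiener_bound r (d / 4)"
  proof (rule wiener_boundI)
    show "integrable lborel (\<lambda>x. k x - f x)" using k f by simp
    show "fourier (\<lambda>x. k x - f x) y = r y" for y using k f by (simp add: fourier_diff r_def)
    show "L1_norm (\<lambda>x. k x - f x) \<le> d / 4"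
      using k(2) by (simp add: L1_norm_def norm_minus_commute)
  qed
  have PF: "P y - r y = 1 + fourier f y" for y by (simp add: P_def r_def)
  have m: "0 < m" "m \<le> 1" using d by (auto simp: m_def)
  have P: "m \<le> norm (P y)" for y
    using wiener_bound_norm_le[OF r, of y] norm_triangle_ineq4[of "P y" "r y"] d(3)[of y]
    unfolding PF m_def by simp
  have rP: "norm (r y) < norm (P y)" for y
    using wiener_bound_norm_le[OF r, of y] P[of y] d(1) unfolding m_def by simp
  have Q: "wiener_bound (\<lambda>y. 1 / P y ^ n - 1) (real ((n + 1)\<^sup>2) * (1 / m) ^ (n + 2) * C)" for n
    unfolding P_def C_def
    by (rule wiener_bound_inverse_power[OF D H norm_fourier_le m P[unfolded P_def]])
  \<comment> \<open>The term with \<open>r\<close> to the power \<open>n + 1\<close> and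
    \<open>1 / P\<close> to the power \<open>n + 2\<close> is split by replacing the latter by
    itself minus 1, plus 1, so that both parts are transforms. The bound \<open>Q\<close> at
    \<open>n + 2\<close> gives the shifts \<open>n + 3\<close> and \<open>n + 4\<close>.\<close>
  define B where "B = (\<lambda>n. (d / 4) ^ Suc n * (real ((n + 3)\<^sup>2) * (1 / m) ^ (n + 4) * C) + (d / 4) ^ Suc n)"
  have tm: "wiener_bound (\<lambda>y. r y ^ Suc n * (1 / P y) ^ Suc (Suc n)) (B n)" for n
  proof -
    have "wiener_bound (\<lambda>y. r y ^ Suc n * (1 / P y ^ (n + 2) - 1) + r y ^ Suc n)
       ((d / 4) ^ Suc n * (real ((n + 2 + 1)\<^sup>2) * (1 / m) ^ (n + 2 + 2) * C) + (d / 4) ^ Suc n)"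
      by (intro wiener_bound_add wiener_bound_mult wiener_bound_power r Q)
    moreover have "r y ^ Suc n * (1 / P y ^ (n + 2) - 1) + r y ^ Suc n = r y ^ Suc n * (1 / P y) ^ Suc (Suc n)" for y
      by (simp add: power_one_over algebra_simps)
    moreover have "n + 2 + 1 = n + 3" "n + 2 + 2 = n + 4" by simp_all
    ultimately show ?thesis by (simp only: B_def)
  qed
  have "summable B"
  proof -
    \<comment> \<open>The choice \<open>d / 4\<close> makes the ratio to \<open>m\<close> equal to
      1/3; against the quadratic factor, comparison with powers of 1/2 suffices.\<close>
    have q: "d / 4 * (1 / m) = 1 / 3" using d(1) by (simp add: m_def)
    have "(d / 4) ^ Suc n * (real ((n + 3)\<^sup>2) * (1 / m) ^ (n + 4) * C)
        = C * (1 / m) ^ 3 * (real ((n + 3)\<^sup>2) * (1 / 3) ^ Suc n)" for n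
    proof -
      have "(1 / m) ^ (n + 4) = (1 / m) ^ Suc n * (1 / m) ^ 3"
        by (simp add: numeral_eq_Suc)
      then show ?thesis
        unfolding q[symmetric] power_mult_distrib by (simp only: mult_ac)
    qed
    moreover have "summable (\<lambda>n. real ((n + 3)\<^sup>2) * (1 / 3) ^ Suc n)"
    proof (rule summable_comparison_test_bigo)
      show "summable (\<lambda>n. norm ((1 / 2 :: real) ^ n))" by simp
      show "(\<lambda>n. real ((n + 3)\<^sup>2) * (1 / 3) ^ Suc n) \<in> O(\<lambda>n. (1 / 2) ^ n)" by real_asymp
    qed
    moreover have "summable (\<lambda>n. (d / 4) ^ Suc n)"
      using d by (subst summable_Suc_iff) (simp add: summable_geometric)
    ultimately show ?thesis
      unfolding B_def by (intro summable_add) (simp_all only: summable_mult)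
  qed
  from wiener_bound_suminf[OF tm this]
  have series: "wiener_bound (\<lambda>y. \<Sum>n. r y ^ Suc n * (1 / P y) ^ Suc (Suc n)) (suminf B)" .
  \<comment> \<open>The zeroth term \<open>1 / P y\<close> is set apart: it is no transform by
    itself, but becomes one with the subtracted 1.\<close>
  have "1 / (1 + fourier f y) - 1
      = (1 / P y ^ 1 - 1) + (\<Sum>n. r y ^ Suc n * (1 / P y) ^ Suc (Suc n))" for y
  proof -
    have s: "(\<lambda>n. r y ^ n * (1 / P y) ^ Suc n) sums (1 / (1 + fourier f y))"
      using inverse_diff_sums[OF rP[of y]] unfolding PF .
    show ?thesis
      using suminf_split_head[OF sums_summable[OF s]] sums_unique[OF s] by simp
  qed
  with wiener_bound_add[OF Q[of 1] series]
  have "wiener_bound (\<lambda>y. 1 / (1 + fourier f y) - 1) (real ((1 + 1)\<^sup>2) * (1 / m) ^ (1 + 2) * C + suminf B)"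
    by (simp only:)
  then show ?thesis
    using that unfolding wiener_bound_def by metis
qed

section \<open>The transforms of both convolutions\<close>

lemma cos_transform_eq_fourier:
  assumes f: "integrable lborel f"
  shows "cos_transform f y = complex_of_real (1 / sqrt (2 * pi)) * ((fourier f y + fourier f (- y)) / 2)"
proof -
  have "(fourier f y + fourier f (- y)) / 2 = (LINT x|lborel. (f x * cis (x * y) + f x * cis (x * - y)) / 2)"
    unfolding fourier_def by (simp add: integrable_mult_cis[OF f, of y] integrable_mult_cis[OF f, of "- y", simplified])
  also have "\<dots> = (LINT x|lborel. f x * complex_of_real (cos (x * y)))"
    by (intro Bochner_Integration.integral_cong) (simp_all add: complex_eq_iff cis.sel algebra_simps)
  finally show ?thesis by (simp add: cos_transform_def)
qed

lemma cos_transform_uminus: "cos_transform f (- y) = cos_transform f y"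
  by (simp add: cos_transform_def)

text \<open>Reflecting \<open>g\<close> turns \<open>f (x + u)\<close> into
  \<open>f (x - u)\<close>. Splitting the integral of the sum uses integrability of both sections,
  true for almost every \<open>x\<close>; elsewhere the default value 0 may break the
  identity.\<close>

lemma cos_conv_AE:
  assumes f: "integrable lborel f" and g: "integrable lborel g"
  shows "AE x in lborel. cos_conv f g x =
    complex_of_real (1 / (2 * sqrt (2 * pi))) * (convol f (\<lambda>u. g (- u)) x + convol f g x)"
proof -
  have g': "integrable lborel (\<lambda>u. g (- u))" using integrable_reflect[OF g, of 0] by simp
  have 1: "AE x in lborel. integrable lborel (\<lambda>u. f (x - u) * g u)"
    using lborel_pair.AE_integrable_fst'[OF integrable_convol_pair[OF f g]] by simp
  have 2: "AE x in lborel. integrable lborel (\<lambda>u. f (x - u) * g (- u))"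
    using lborel_pair.AE_integrable_fst'[OF integrable_convol_pair[OF f g']] by simp
  show ?thesis
    using 1 2
  proof eventually_elim
    fix x assume int: "integrable lborel (\<lambda>u. f (x - u) * g u)" "integrable lborel (\<lambda>u. f (x - u) * g (- u))"
    have int': "integrable lborel (\<lambda>u. f (x + u) * g u)"
      using integrable_reflect[OF int(2), of 0] by simp
    have "(LINT u|lborel. f (x + u) * g u) = convol f (\<lambda>u. g (- u)) x"
      unfolding convol_def using integral_reflect[of "\<lambda>u. f (x + u) * g u" 0] by simp
    then show "cos_conv f g x =
      complex_of_real (1 / (2 * sqrt (2 * pi))) * (convol f (\<lambda>u. g (- u)) x + convol f g x)"
      using int int' by (simp add: cos_conv_def convol_def distrib_right)
  qed
qed

lemma borel_measurable_cos_conv: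
  assumes "integrable lborel f" "integrable lborel g"
  shows "cos_conv f g \<in> borel_measurable lborel"
proof -
  have [measurable]: "f \<in> borel_measurable borel" "g \<in> borel_measurable borel"
    using assms by (auto dest: borel_measurable_integrable)
  show ?thesis unfolding cos_conv_def[abs_def] by measurable
qed

lemma
  assumes f: "integrable lborel f" and g: "integrable lborel g"
  shows integrable_cos_conv: "integrable lborel (cos_conv f g)"
    and fourier_cos_conv: "fourier (cos_conv f g) y =
      complex_of_real (1 / (2 * sqrt (2 * pi))) * (fourier f y * (fourier g y + fourier g (- y)))"
proof -
  let ?c = "complex_of_real (1 / (2 * sqrt (2 * pi)))"
  let ?h = "\<lambda>x. ?c * (convol f (\<lambda>u. g (- u)) x + convol f g x)"
  have g': "integrable lborel (\<lambda>u. g (- u))" using integrable_reflect[OF g, of 0] by simp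
  have int: "integrable lborel (\<lambda>x. convol f (\<lambda>u. g (- u)) x + convol f g x)"
    by (intro Bochner_Integration.integrable_add integrable_convol f g g')
  then have inth: "integrable lborel ?h" by (rule integrable_mult_right)
  note meas = borel_measurable_cos_conv[OF f g] borel_measurable_integrable[OF inth]
  show "integrable lborel (cos_conv f g)"
    using integrable_cong_AE[OF meas cos_conv_AE[OF f g]] inth by blast
  show "fourier (cos_conv f g) y = ?c * (fourier f y * (fourier g y + fourier g (- y)))"
    unfolding fourier_cong_AE[OF cos_conv_AE[OF f g] meas] fourier_cmult
    using f g g' by (simp add: fourier_add integrable_convol fourier_convol fourier_reflect distrib_left)
qed

section \<open>The Gaussian-weighted convolution\<close>

lemma integral_sign_flip:
  fixes h :: "real \<Rightarrow> 'a::{banach, second_countable_topology}"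
  assumes "a \<in> {1, -1}"
  shows "(LINT u|lborel. h (a * u)) = (LINT u|lborel. h u)"
  using assms lborel_integral_real_affine[of a h 0] by auto

lemma integrable_sign_flip:
  fixes h :: "real \<Rightarrow> 'a::{banach, second_countable_topology}"
  assumes "a \<in> {1, -1}" "integrable lborel h"
  shows "integrable lborel (\<lambda>u. h (a * u))"
  using assms(1) lborel_integrable_real_affine[OF assms(2), of a 0] by auto

lemma fourier_sign_flip:
  assumes a: "a \<in> {1, -1}"
  shows "fourier (\<lambda>x. f (a * x)) y = fourier f (a * y)"
  using a by (auto simp: fourier_reflect)

text \<open>The contribution of one of the four kernel summands, with signs \<open>a\<close> and
  \<open>b\<close>, encoded as an iterated convolution so that transform and norm bound follow from
  those of \<open>convol\<close>.\<close>

definition gauss_term :: "real \<Rightarrow> real \<Rightarrow> (real \<Rightarrow> complex) \<Rightarrow> (real \<Rightarrow> complex) \<Rightarrow> real \<Rightarrow> complex" where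
  "gauss_term a b f g = convol (convol (\<lambda>x. complex_of_real (exp (- x\<^sup>2 / 2))) (\<lambda>u. f (a * u))) (\<lambda>v. g (b * v))"

text \<open>The Gaussian is bounded by 1, so the integrand is integrable along with the product of
  \<open>f\<close> and \<open>g\<close>; Fubini and the sign changes of both variables, where
  \<open>a * a = b * b = 1\<close>, give the convolutions. The first part serves to split the kernel
  sum.\<close>

lemma gauss_term_eq:
  assumes f: "integrable lborel f" and g: "integrable lborel g" and ab: "a \<in> {1, -1}" "b \<in> {1, -1}"
  shows "integrable lborel (\<lambda>p. f (fst p) * g (snd p) * complex_of_real (exp (- (x - a * fst p - b * snd p)\<^sup>2 / 2)))"
    and "(LINT p|lborel. f (fst p) * g (snd p) * complex_of_real (exp (- (x - a * fst p - b * snd p)\<^sup>2 / 2)))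
      = gauss_term a b f g x"
proof -
  let ?E = "\<lambda>x. complex_of_real (exp (- x\<^sup>2 / 2))"
  have [measurable]: "f \<in> borel_measurable borel" "g \<in> borel_measurable borel"
    using f g by (auto dest: borel_measurable_integrable)
  have "integrable (lborel \<Otimes>\<^sub>M lborel) (\<lambda>(u, v). f u * g v)"
  proof (rule lborel_pair.Fubini_integrable)
    show "integrable lborel (\<lambda>u. LINT v|lborel. norm (case (u, v) of (u, v) \<Rightarrow> f u * g v))"
      using f by (simp add: norm_mult)
    show "AE u in lborel. integrable lborel (\<lambda>v. case (u, v) of (u, v) \<Rightarrow> f u * g v)"
      using g by simp
  qed measurable
  then have int0: "integrable (lborel \<Otimes>\<^sub>M lborel) (\<lambda>p. f (fst p) * g (snd p))"
    by (simp add: split_beta')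
  have int: "integrable (lborel \<Otimes>\<^sub>M lborel) (\<lambda>p. f (fst p) * g (snd p) * ?E (x - a * fst p - b * snd p))"
    by (rule integrable_mult_bounded[OF int0, where B = 1]) auto
  then show "integrable lborel (\<lambda>p. f (fst p) * g (snd p) * ?E (x - a * fst p - b * snd p))"
    by (simp only: lborel_prod)
  have int2: "integrable (lborel \<Otimes>\<^sub>M lborel) (\<lambda>(u, v). f u * g v * ?E (x - a * u - b * v))"
    using int by (simp add: split_beta')
  have inner: "(LINT u|lborel. f u * ?E (z - a * u)) = convol ?E (\<lambda>u. f (a * u)) z" for z
  proof -
    have "(LINT u|lborel. f u * ?E (z - a * u)) = (LINT u|lborel. f (a * u) * ?E (z - a * (a * u)))"
      using integral_sign_flip[OF ab(1), of "\<lambda>u. f u * ?E (z - a * u)"] by simp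
    then show ?thesis unfolding convol_def using ab by (auto simp: mult.commute)
  qed
  have "(LINT p|lborel. f (fst p) * g (snd p) * ?E (x - a * fst p - b * snd p))
      = (LINT p|(lborel \<Otimes>\<^sub>M lborel). f (fst p) * g (snd p) * ?E (x - a * fst p - b * snd p))"
    by (simp only: lborel_prod)
  also have "\<dots> = (LINT u|lborel. LINT v|lborel. f u * g v * ?E (x - a * u - b * v))"
    using lborel_pair.integral_fst'[OF int] by simp
  also have "\<dots> = (LINT v|lborel. LINT u|lborel. f u * g v * ?E (x - a * u - b * v))"
    by (rule lborel_pair.Fubini_integral[OF int2, symmetric])
  also have "\<dots> = (LINT v|lborel. g v * convol ?E (\<lambda>u. f (a * u)) (x - b * v))"
  proof (rule Bochner_Integration.integral_cong[OF refl])
    fix v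
    have "(LINT u|lborel. f u * g v * ?E (x - a * u - b * v)) = (LINT u|lborel. g v * (f u * ?E (x - b * v - a * u)))"
      by (intro Bochner_Integration.integral_cong refl) (simp add: mult_ac diff_diff_add add.commute)
    then show "(LINT u|lborel. f u * g v * ?E (x - a * u - b * v)) = g v * convol ?E (\<lambda>u. f (a * u)) (x - b * v)"
      by (simp only: integral_mult_right_zero inner)
  qed
  also have "\<dots> = (LINT v|lborel. g (b * v) * convol ?E (\<lambda>u. f (a * u)) (x - b * (b * v)))"
    using integral_sign_flip[OF ab(2), of "\<lambda>v. g v * convol ?E (\<lambda>u. f (a * u)) (x - b * v)"] by simp
  also have "\<dots> = gauss_term a b f g x"
    unfolding gauss_term_def convol_def[of "convol ?E (\<lambda>u. f (a * u))"] using ab by (auto simp: mult.commute)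
  finally show "(LINT p|lborel. f (fst p) * g (snd p) * ?E (x - a * fst p - b * snd p)) = gauss_term a b f g x" .
qed

lemma gauss_conv_eq:
  assumes f: "integrable lborel f" and g: "integrable lborel g"
  shows "gauss_conv f g = (\<lambda>x. complex_of_real (1 / (8 * pi)) *
    (gauss_term (-1) (-1) f g x + gauss_term (-1) 1 f g x + gauss_term 1 (-1) f g x + gauss_term 1 1 f g x))"
proof
  fix x
  let ?t = "\<lambda>a b p. f (fst p) * g (snd p) * complex_of_real (exp (- (x - a * fst p - b * snd p)\<^sup>2 / 2))"
  have "(LINT p|(lborel :: (real \<times> real) measure). f (fst p) * g (snd p) * complex_of_real (gauss_kernel x (fst p) (snd p)))
      = (LINT p|lborel. ?t (-1) (-1) p + ?t (-1) 1 p + ?t 1 (-1) p + ?t 1 1 p)"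
    by (intro Bochner_Integration.integral_cong) (simp_all add: gauss_kernel_def distrib_left)
  also have "\<dots> = (LINT p|lborel. ?t (-1) (-1) p) + (LINT p|lborel. ?t (-1) 1 p) + (LINT p|lborel. ?t 1 (-1) p) + (LINT p|lborel. ?t 1 1 p)"
  proof -
    have i: "integrable lborel (?t (-1) (-1))" "integrable lborel (?t (-1) 1)" "integrable lborel (?t 1 (-1))" "integrable lborel (?t 1 1)"
      by (intro gauss_term_eq(1)[OF f g]; simp)+
    show ?thesis
      by (simp only: i Bochner_Integration.integral_add Bochner_Integration.integrable_add)
  qed
  also have "\<dots> = gauss_term (-1) (-1) f g x + gauss_term (-1) 1 f g x + gauss_term 1 (-1) f g x + gauss_term 1 1 f g x"
    by (intro arg_cong2[where f = "(+)"] gauss_term_eq(2)[OF f g]) auto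
  finally show "gauss_conv f g x = complex_of_real (1 / (8 * pi)) *
    (gauss_term (-1) (-1) f g x + gauss_term (-1) 1 f g x + gauss_term 1 (-1) f g x + gauss_term 1 1 f g x)"
    by (simp add: gauss_conv_def)
qed

lemma integrable_exp_gauss_1: "integrable lborel (\<lambda>x. complex_of_real (exp (- x\<^sup>2 / 2)))"
  using integrable_exp_gauss[of 1] by simp

lemma fourier_exp_gauss_1:
  "fourier (\<lambda>x. complex_of_real (exp (- x\<^sup>2 / 2))) y = complex_of_real (sqrt (2 * pi) * exp (- y\<^sup>2 / 2))"
proof -
  have "fourier (\<lambda>x. complex_of_real (exp (- x\<^sup>2 / 2))) y
      = complex_of_real (2 * pi / sqrt (2 * pi) * exp (- y\<^sup>2 / 2))"
    using fourier_exp_gauss_cis[of 1 0 y]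
    by (simp add: gauss_mollifier_def std_normal_density_def flip: of_real_mult of_real_divide)
  moreover have "2 * pi / sqrt (2 * pi) = sqrt (2 * pi)" by (rule real_div_sqrt) simp
  ultimately show ?thesis by (simp only:)
qed

text \<open>For a nonnegative function the norm is the transform at 0.\<close>

lemma L1_norm_exp_gauss_1: "L1_norm (\<lambda>x. complex_of_real (exp (- x\<^sup>2 / 2))) = sqrt (2 * pi)"
proof -
  have "complex_of_real (L1_norm (\<lambda>x. complex_of_real (exp (- x\<^sup>2 / 2)))) = fourier (\<lambda>x. complex_of_real (exp (- x\<^sup>2 / 2))) 0"
    by (simp add: L1_norm_def fourier_def)
  then show ?thesis by (simp only: fourier_exp_gauss_1 of_real_eq_iff) simp
qed

lemma
  assumes f: "integrable lborel f" and g: "integrable lborel g" and ab: "a \<in> {1, -1}" "b \<in> {1, -1}"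
  shows integrable_gauss_term: "integrable lborel (gauss_term a b f g)"
    and fourier_gauss_term: "fourier (gauss_term a b f g) y
      = complex_of_real (sqrt (2 * pi) * exp (- y\<^sup>2 / 2)) * fourier f (a * y) * fourier g (b * y)"
    and L1_norm_gauss_term_le: "L1_norm (gauss_term a b f g) \<le> sqrt (2 * pi) * L1_norm f * L1_norm g"
proof -
  note f' = integrable_sign_flip[OF ab(1) f] and g' = integrable_sign_flip[OF ab(2) g]
  note E = integrable_exp_gauss_1
  show "integrable lborel (gauss_term a b f g)"
    unfolding gauss_term_def by (intro integrable_convol E f' g')
  show "fourier (gauss_term a b f g) y
      = complex_of_real (sqrt (2 * pi) * exp (- y\<^sup>2 / 2)) * fourier f (a * y) * fourier g (b * y)"
    unfolding gauss_term_def fourier_convol[OF integrable_convol[OF E f'] g'] fourier_convol[OF E f']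
      fourier_sign_flip[OF ab(1)] fourier_sign_flip[OF ab(2)] fourier_exp_gauss_1 ..
  have "L1_norm (\<lambda>u. f (a * u)) = L1_norm f" "L1_norm (\<lambda>u. g (b * u)) = L1_norm g"
    unfolding L1_norm_def using ab by (auto intro!: integral_sign_flip[of _ "\<lambda>x. norm (_ x)"])
  with L1_norm_convol_le[OF E f'] have "L1_norm (convol (\<lambda>x. complex_of_real (exp (- x\<^sup>2 / 2))) (\<lambda>u. f (a * u))) \<le> sqrt (2 * pi) * L1_norm f"
    by (simp only: L1_norm_exp_gauss_1)
  then have "L1_norm (convol (\<lambda>x. complex_of_real (exp (- x\<^sup>2 / 2))) (\<lambda>u. f (a * u))) * L1_norm (\<lambda>v. g (b * v))
      \<le> sqrt (2 * pi) * L1_norm f * L1_norm g"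
    unfolding \<open>L1_norm (\<lambda>u. g (b * u)) = L1_norm g\<close> using L1_norm_nonneg by (rule mult_right_mono)
  with L1_norm_convol_le[OF integrable_convol[OF E f'] g']
  show "L1_norm (gauss_term a b f g) \<le> sqrt (2 * pi) * L1_norm f * L1_norm g"
    unfolding gauss_term_def by (rule order_trans)
qed

lemma integrable_gauss_conv:
  assumes f: "integrable lborel f" and g: "integrable lborel g"
  shows "integrable lborel (gauss_conv f g)"
  unfolding gauss_conv_eq[OF f g]
  by (intro integrable_mult_right Bochner_Integration.integrable_add integrable_gauss_term f g) auto

text \<open>Summed over all signs, the four terms factor into two even parts of transforms, that is,
  into cosine transforms; \<open>1 / (8 * pi)\<close> is a quarter of the square of
  \<open>1 / sqrt (2 * pi)\<close>, just the constant they absorb.\<close>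

lemma fourier_gauss_conv:
  assumes f: "integrable lborel f" and g: "integrable lborel g"
  shows "fourier (gauss_conv f g) y
    = complex_of_real (sqrt (2 * pi) * exp (- y\<^sup>2 / 2)) * cos_transform f y * cos_transform g y"
proof -
  let ?G = "complex_of_real (sqrt (2 * pi) * exp (- y\<^sup>2 / 2))"
  have i: "integrable lborel (gauss_term a b f g)" if "a \<in> {1, -1}" "b \<in> {1, -1}" for a b
    using integrable_gauss_term[OF f g that] .
  have "fourier (gauss_conv f g) y = complex_of_real (1 / (8 * pi)) *
      (fourier (gauss_term (-1) (-1) f g) y + fourier (gauss_term (-1) 1 f g) y
        + fourier (gauss_term 1 (-1) f g) y + fourier (gauss_term 1 1 f g) y)"
    unfolding gauss_conv_eq[OF f g] fourier_cmult
    by (simp add: fourier_add i)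
  also have "\<dots> = complex_of_real (1 / (8 * pi)) * (?G * (fourier f y + fourier f (- y)) * (fourier g y + fourier g (- y)))"
    by (simp add: fourier_gauss_term[OF f g] algebra_simps)
  also have "\<dots> = ?G * cos_transform f y * cos_transform g y"
  proof -
    have "complex_of_real (1 / (8 * pi)) = complex_of_real (1 / sqrt (2 * pi)) * complex_of_real (1 / sqrt (2 * pi)) / 4"
    proof -
      have "1 / (8 * pi) = 1 / sqrt (2 * pi) * (1 / sqrt (2 * pi)) / 4" by simp
      then show ?thesis by (simp only: of_real_mult of_real_divide of_real_numeral of_real_1)
    qed
    then show ?thesis
      unfolding cos_transform_eq_fourier[OF f] cos_transform_eq_fourier[OF g] by (simp only:) (simp add: mult_ac)
  qed
  finally show ?thesis .
qed

text \<open>Each of the four terms has norm at most \<open>?B\<close>, and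
  \<open>4 * sqrt (2 * pi) / (8 * pi)\<close> equals \<open>1 / sqrt (2 * pi)\<close>.\<close>

lemma L1_norm_gauss_conv_le:
  assumes f: "integrable lborel f" and g: "integrable lborel g"
  shows "L1_norm (gauss_conv f g) \<le> 1 / sqrt (2 * pi) * L1_norm f * L1_norm g"
proof -
  let ?t = "\<lambda>a b. gauss_term a b f g"
  let ?B = "sqrt (2 * pi) * L1_norm f * L1_norm g"
  have i: "integrable lborel (?t a b)" if "a \<in> {1, -1}" "b \<in> {1, -1}" for a b
    using integrable_gauss_term[OF f g that] .
  have "L1_norm (gauss_conv f g) \<le> (LINT x|lborel. 1 / (8 * pi) *
      (norm (?t (-1) (-1) x) + norm (?t (-1) 1 x) + norm (?t 1 (-1) x) + norm (?t 1 1 x)))"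
    unfolding L1_norm_def
  proof (rule integral_mono)
    fix x
    show "norm (gauss_conv f g x) \<le> 1 / (8 * pi) *
      (norm (?t (-1) (-1) x) + norm (?t (-1) 1 x) + norm (?t 1 (-1) x) + norm (?t 1 1 x))"
      unfolding gauss_conv_eq[OF f g] norm_mult
      by (intro mult_mono norm_triangle_le add_mono order_refl) (auto simp: norm_divide)
  next
    show "integrable lborel (\<lambda>x. 1 / (8 * pi) *
      (norm (?t (-1) (-1) x) + norm (?t (-1) 1 x) + norm (?t 1 (-1) x) + norm (?t 1 1 x)))"
      by (intro integrable_mult_right Bochner_Integration.integrable_add integrable_norm i) auto
  qed (use integrable_gauss_conv[OF f g] in auto)
  also have "\<dots> = 1 / (8 * pi) * (L1_norm (?t (-1) (-1)) + L1_norm (?t (-1) 1) + L1_norm (?t 1 (-1)) + L1_norm (?t 1 1))"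
    by (simp add: L1_norm_def i)
  also have "\<dots> \<le> 1 / (8 * pi) * (?B + ?B + ?B + ?B)"
    by (intro mult_left_mono add_mono L1_norm_gauss_term_le f g) auto
  also have "\<dots> = 1 / sqrt (2 * pi) * L1_norm f * L1_norm g"
  proof -
    have "1 / (8 * pi) * (4 * sqrt (2 * pi)) = 1 / sqrt (2 * pi)"
    proof -
      have "sqrt (2 * pi) * sqrt (2 * pi) = 2 * pi" by simp
      then show ?thesis by (simp add: divide_simps del: real_sqrt_mult real_sqrt_mult_self)
    qed
    moreover have "1 / (8 * pi) * (?B + ?B + ?B + ?B) = (1 / (8 * pi) * (4 * sqrt (2 * pi))) * L1_norm f * L1_norm g"
      by (simp only: mult_ac) simp
    ultimately show ?thesis by (simp only:)
  qed
  finally show ?thesis .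
qed

section \<open>The convolution equation\<close>

text \<open>Both sides of the equation are integrable, so injectivity makes equality almost
  everywhere the same as equality of transforms at every point.\<close>

lemma L1_solution_iff_fourier:
  assumes g: "integrable lborel g" and \<psi>: "integrable lborel \<psi>" and f: "integrable lborel f"
  shows "L1_solution g \<psi> f \<longleftrightarrow>
    (\<forall>y. fourier f y + complex_of_real (1 / (2 * sqrt (2 * pi))) * (fourier g y * (fourier f y + fourier f (- y)))
      = fourier (gauss_conv g \<psi>) y)"
proof -
  note int = f integrable_cos_conv[OF g f] integrable_gauss_conv[OF g \<psi>]
  have intl: "integrable lborel (\<lambda>x. f x + cos_conv g f x)" using int by simp
  have eq: "fourier (\<lambda>x. f x + cos_conv g f x) y
      = fourier f y + complex_of_real (1 / (2 * sqrt (2 * pi))) * (fourier g y * (fourier f y + fourier f (- y)))" for y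
    by (simp only: fourier_add[OF int(1,2)] fourier_cos_conv[OF g f])
  show ?thesis
    unfolding L1_solution_def eq[symmetric]
    using f fourier_inject[OF intl int(3)]
      fourier_cong_AE[OF _ borel_measurable_integrable[OF intl] borel_measurable_integrable[OF int(3)]]
    by blast
qed

lemma cos_transform_eq_fourier':
  assumes "integrable lborel f"
  shows "complex_of_real (1 / (2 * sqrt (2 * pi))) * (fourier f y + fourier f (- y)) = cos_transform f y"
  unfolding cos_transform_eq_fourier[OF assms] by simp

lemma fourier_gauss_conv_uminus:
  assumes "integrable lborel f" "integrable lborel g"
  shows "fourier (gauss_conv f g) (- y) = fourier (gauss_conv f g) y"
  by (simp add: fourier_gauss_conv[OF assms] cos_transform_uminus)

text \<open>The formula for the transform no longer contains \<open>f\<close> on the right: this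
  yields uniqueness and shows how a solution must be built.\<close>

lemma L1_solution_fourier:
  assumes g: "integrable lborel g" and \<psi>: "integrable lborel \<psi>"
    and ne: "1 + cos_transform g y \<noteq> 0"
    and sol: "L1_solution g \<psi> f"
  shows "fourier f y = fourier (gauss_conv g \<psi>) y
    - complex_of_real (1 / sqrt (2 * pi)) * fourier g y * (fourier (gauss_conv g \<psi>) y / (1 + cos_transform g y))"
proof -
  let ?h = "fourier (gauss_conv g \<psi>) y" and ?S = "fourier f y + fourier f (- y)"
  let ?c = "complex_of_real (1 / (2 * sqrt (2 * pi)))"
  have f: "integrable lborel f" using sol by (simp add: L1_solution_def)
  have *: "fourier f z + ?c * (fourier g z * (fourier f z + fourier f (- z))) = fourier (gauss_conv g \<psi>) z" for z
    using sol L1_solution_iff_fourier[OF g \<psi> f] by blast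
  have 1: "fourier f y + ?c * (fourier g y * ?S) = ?h" using *[of y] .
  have 2: "fourier f (- y) + ?c * (fourier g (- y) * ?S) = ?h"
    using *[of "- y"] by (simp only: minus_minus add.commute[of "fourier f (- y)"] fourier_gauss_conv_uminus[OF g \<psi>])
  \<comment> \<open>Adding the equations at \<open>y\<close> and \<open>- y\<close> leaves
    \<open>?S\<close> as the only unknown.\<close>
  have "?S + ?c * (fourier g y + fourier g (- y)) * ?S = 2 * ?h"
    using arg_cong2[OF 1 2, of "(+)"] by (simp only: algebra_simps mult_2)
  then have "(1 + cos_transform g y) * ?S = 2 * ?h"
    unfolding cos_transform_eq_fourier'[OF g] by (simp only: distrib_right mult_1_left)
  then have S: "?S = 2 * (?h / (1 + cos_transform g y))"
    using ne by (simp add: field_simps)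
  have "fourier f y = ?h - ?c * (fourier g y * ?S)" using 1 by (simp only: eq_diff_eq)
  also have "?c * (fourier g y * ?S) = complex_of_real (1 / sqrt (2 * pi)) * fourier g y * (?h / (1 + cos_transform g y))"
    unfolding S by simp
  finally show ?thesis .
qed

text \<open>Applying Wiener's lemma to the even part of \<open>g\<close> inverts \<open>1 + T\<^sub>c g\<close>.\<close>

lemma inverse_one_plus_cos_transform:
  assumes g: "integrable lborel g" and ne: "\<And>y. 1 + cos_transform g y \<noteq> 0"
  obtains k where "integrable lborel k" "\<And>y. fourier k y = 1 / (1 + cos_transform g y) - 1"
proof -
  let ?c = "complex_of_real (1 / (2 * sqrt (2 * pi)))"
  have g': "integrable lborel (\<lambda>x. g (- x))" using integrable_reflect[OF g, of 0] by simp
  have e: "integrable lborel (\<lambda>x. ?c * (g x + g (- x)))"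
    by (intro integrable_mult_right Bochner_Integration.integrable_add g g')
  have "fourier (\<lambda>x. ?c * (g x + g (- x))) y = cos_transform g y" for y
    by (simp only: fourier_cmult fourier_add[OF g g'] fourier_reflect cos_transform_eq_fourier'[OF g])
  with wiener_lemma[OF e] ne that show ?thesis by auto
qed

lemma L1_solution_exists:
  assumes g: "integrable lborel g" and \<psi>: "integrable lborel \<psi>"
    and ne: "\<And>y. 1 + cos_transform g y \<noteq> 0"
  shows "\<exists>f. L1_solution g \<psi> f"
proof -
  obtain k where k: "integrable lborel k" "\<And>y. fourier k y = 1 / (1 + cos_transform g y) - 1"
    by (rule inverse_one_plus_cos_transform[OF g ne], rule that)
  let ?h = "gauss_conv g \<psi>"
  let ?H = "fourier ?h" and ?T = "cos_transform g"
  let ?c = "complex_of_real (1 / (2 * sqrt (2 * pi)))"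
  \<comment> \<open>\<open>q\<close> is made to have the transform \<open>?H y / (1 + ?T y)\<close>;
    then \<open>f\<close> realises the formula of \<open>L1_solution_fourier\<close>, as
    \<open>2 * ?c\<close> is \<open>1 / sqrt (2 * pi)\<close>.\<close>
  define q where "q = (\<lambda>x. ?h x + convol k ?h x)"
  define f where "f = (\<lambda>x. ?h x - 2 * ?c * convol g q x)"
  note h = integrable_gauss_conv[OF g \<psi>]
  have q: "integrable lborel q"
    unfolding q_def by (intro Bochner_Integration.integrable_add h integrable_convol k)
  have Fq: "fourier q y = ?H y / (1 + ?T y)" for y
    unfolding q_def using ne[of y]
    by (simp add: fourier_add[OF h integrable_convol[OF k(1) h]] fourier_convol[OF k(1) h] k(2) field_simps)
  have f: "integrable lborel f"
    unfolding f_def by (intro Bochner_Integration.integrable_diff integrable_mult_right h integrable_convol g q)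
  have Ff: "fourier f y = ?H y - 2 * ?c * (fourier g y * (?H y / (1 + ?T y)))" for y
    unfolding f_def
    by (simp only: fourier_diff[OF h integrable_mult_right[OF integrable_convol[OF g q]]] fourier_cmult
        fourier_convol[OF g q] Fq)
  have "fourier f y + fourier f (- y) = 2 * (?H y / (1 + ?T y))" for y
  proof -
    have "fourier f y + fourier f (- y) = 2 * ?H y - 2 * (?c * (fourier g y + fourier g (- y))) * (?H y / (1 + ?T y))"
      unfolding Ff fourier_gauss_conv_uminus[OF g \<psi>] cos_transform_uminus by (simp only: algebra_simps mult_2)
    also have "\<dots> = 2 * (?H y / (1 + ?T y))"
      unfolding cos_transform_eq_fourier'[OF g] using ne[of y] by (simp add: field_simps)
    finally show ?thesis .
  qed
  then have "L1_solution g \<psi> f"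
    unfolding L1_solution_iff_fourier[OF g \<psi> f] Ff by (simp add: mult_ac)
  then show ?thesis by blast
qed

lemma L1_resolvent_exists:
  assumes g: "integrable lborel g" and ne: "\<And>y. 1 + cos_transform g y \<noteq> 0"
  shows "\<exists>l. L1_resolvent g l"
proof -
  obtain k where k: "integrable lborel k" "\<And>y. fourier k y = 1 / (1 + cos_transform g y) - 1"
    by (rule inverse_one_plus_cos_transform[OF g ne], rule that)
  \<comment> \<open>From \<open>t / (1 + t) = - (1 / (1 + t) - 1)\<close>; the factor
    \<open>sqrt (2 * pi)\<close> undoes the normalisation of the cosine transform, and the transform
    of \<open>k\<close> is already even.\<close>
  let ?l = "\<lambda>x. complex_of_real (- sqrt (2 * pi)) * k x"
  have l: "integrable lborel ?l" using k(1) by (rule integrable_mult_right)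
  have "cos_transform ?l y = cos_transform g y / (1 + cos_transform g y)" for y
  proof -
    have "cos_transform ?l y = - (complex_of_real (1 / sqrt (2 * pi)) * complex_of_real (sqrt (2 * pi)))
        * (1 / (1 + cos_transform g y) - 1)"
      unfolding cos_transform_eq_fourier[OF l] fourier_cmult k(2) cos_transform_uminus by simp
    also have "complex_of_real (1 / sqrt (2 * pi)) * complex_of_real (sqrt (2 * pi)) = 1"
      by (simp flip: of_real_mult)
    finally show ?thesis using ne[of y] by (simp add: field_simps)
  qed
  with l show ?thesis unfolding L1_resolvent_def by blast
qed

text \<open>For even \<open>g\<close> the normalised transform of \<open>g\<close> is its cosine
  transform, so the solution formula reduces to the transform of \<open>gauss_conv g \<psi>\<close>
  divided by \<open>1 + cos_transform g y\<close>; this replaces the factor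
  \<open>cos_transform g y\<close> by \<open>cos_transform l y\<close>.\<close>

lemma L1_solution_eq_gauss_conv:
  assumes g: "integrable lborel g" and \<psi>: "integrable lborel \<psi>"
    and ne: "\<And>y. 1 + cos_transform g y \<noteq> 0" and even: "AE x in lborel. g (- x) = g x"
    and sol: "L1_solution g \<psi> f" and res: "L1_resolvent g l"
  shows "AE x in lborel. f x = gauss_conv l \<psi> x"
proof (rule fourier_inject)
  have l: "integrable lborel l" "\<And>y. cos_transform l y = cos_transform g y / (1 + cos_transform g y)"
    using res by (auto simp: L1_resolvent_def)
  show "integrable lborel f" using sol by (simp add: L1_solution_def)
  show "integrable lborel (gauss_conv l \<psi>)" by (rule integrable_gauss_conv[OF l(1) \<psi>])
  fix y
  have "fourier (\<lambda>x. g (- x)) y = fourier g y"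
    using g integrable_reflect[OF g, of 0] by (intro fourier_cong_AE[OF even]) auto
  then have g_even: "fourier g (- y) = fourier g y" by (simp only: fourier_reflect)
  have T: "complex_of_real (1 / sqrt (2 * pi)) * fourier g y = cos_transform g y"
    unfolding cos_transform_eq_fourier[OF g] g_even by simp
  show "fourier f y = fourier (gauss_conv l \<psi>) y"
    unfolding L1_solution_fourier[OF g \<psi> ne sol] T fourier_gauss_conv[OF g \<psi>] fourier_gauss_conv[OF l(1) \<psi>] l(2)
    using ne[of y] by (simp add: field_simps)
qed

text \<open>Evenness of \<open>g\<close> enters the representation because
  \<open>gauss_conv l \<psi>\<close> is always even. The norm bound follows from the representation
  and so holds for every admissible \<open>l\<close>, whatever its odd part.\<close>

theorem theorem4p1:
  fixes g \<psi> :: "real \<Rightarrow> complex"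
  assumes "integrable lborel g"
    and "integrable lborel \<psi>"
    and "\<And>y. 1 + cos_transform g y \<noteq> 0"
  shows "(\<exists>f. L1_solution g \<psi> f \<and>
              (\<forall>h. L1_solution g \<psi> h \<longrightarrow> (AE x in lborel. h x = f x)))
       \<and> (\<exists>l. L1_resolvent g l)
       \<and> ((AE x in lborel. g (- x) = g x) \<longrightarrow>
            (\<forall>f l. L1_solution g \<psi> f \<and> L1_resolvent g l \<longrightarrow>
               (AE x in lborel. f x = gauss_conv l \<psi> x) \<and>
               L1_norm f \<le> 1 / sqrt (2 * pi) * L1_norm l * L1_norm \<psi>))"
proof (intro conjI impI allI)
  obtain f where f: "L1_solution g \<psi> f" using L1_solution_exists[OF assms] by blast
  have "AE x in lborel. h x = f x" if h: "L1_solution g \<psi> h" for h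
  proof (rule fourier_inject)
    show "integrable lborel h" "integrable lborel f" using f h by (auto simp: L1_solution_def)
    show "fourier h y = fourier f y" for y
      by (simp only: L1_solution_fourier[OF assms(1,2,3) f] L1_solution_fourier[OF assms(1,2,3) h])
  qed
  with f show "\<exists>f. L1_solution g \<psi> f \<and> (\<forall>h. L1_solution g \<psi> h \<longrightarrow> (AE x in lborel. h x = f x))" by blast
  show "\<exists>l. L1_resolvent g l" by (rule L1_resolvent_exists[OF assms(1,3)])
next
  fix f l assume even: "AE x in lborel. g (- x) = g x" and fl: "L1_solution g \<psi> f \<and> L1_resolvent g l"
  show eq: "AE x in lborel. f x = gauss_conv l \<psi> x"
    using L1_solution_eq_gauss_conv[OF assms even] fl by blast
  have int: "integrable lborel f" "integrable lborel l"
    using fl by (auto simp: L1_solution_def L1_resolvent_def)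
  have "L1_norm f = L1_norm (gauss_conv l \<psi>)"
    unfolding L1_norm_def using eq int integrable_gauss_conv[OF int(2) assms(2)]
    by (intro integral_cong_AE) auto
  with L1_norm_gauss_conv_le[OF int(2) assms(2)]
  show "L1_norm f \<le> 1 / sqrt (2 * pi) * L1_norm l * L1_norm \<psi>" by simp
qed

end
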